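(* Let $H$ and $G$ be separable Hilbert spaces, let $Q\in L(H)$ be a nonnegative self-adjoint nuclear operator, and let $A\in L(G,H)$ be an injective bounded linear operator. Set $U:=\operatorname{ran}(A)$ and assume that $U$ and $U^\perp$ are $Q$-invariant. Consider the statistical model on $H$ with probability measures $\mathbb{Q}_\gamma=\mathrm{N}(A\beta,\sigma^2Q)$, $\gamma=(\beta,\sigma^2)\in G\times(0,\infty)$, with observation $Y$. Let $G_0\subset G$ be a closed subspace with $G_0\neq\{0\}$ and $G_0\neq G$, and set $U_0:=A(G_0)$. Assume that $U_0$ and $U_0^\perp\cap U$ are $Q$-invariant, that $Q(\Pi_H-\Pi_U)\neq0$ and $Q(\Pi_U-\Pi_{U_0})\neq0$, and that the range of $Q(\Pi_U-\Pi_{U_0})$ is finite dimensional. Define $\lambda,\mu>0$ and $n,m\in\mathbb{N}$ by $$\lambda:=\|Q(\Pi_H-\Pi_U)\|,\qquad \mu:=\|Q(\Pi_U-\Pi_{U_0})\|,$$ $$n:=\dim\ker(\lambda-Q(\Pi_H-\Pi_U)),\qquad m:=\dim\operatorname{ran}(Q(\Pi_U-\Pi_{U_0})).$$ Then for each $\alpha\in(0,1)$ the statistical test $$\delta(Y):=\mathbf{1}\bigg\{\frac{n\lambda}{m\mu}\,\frac{\|\Pi_U(Y)-\Pi_{U_0}(Y)\|^2}{\|\Pi_H(Y)-\Pi_U(Y)\|^2}\ge\mathrm{F}_{m,n,1-\alpha}\bigg\}$$ for the test problem $$H_0:\{\beta\in G_0\}\quad\text{versus}\quad H_1:\{\beta\notin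 G_0\}$$ has level of significance $\alpha$.
   Context: A subspace $V\subset H$ is $Q$-invariant if $Q(V)\subset V$. In the source it is asserted that, due to the open mapping theorem, the injective operator $A$ is an isomorphism $A\in L(G,U)$ and hence $U$ is a closed subspace of $H$. $\Pi_V$ is the orthogonal projection onto a closed subspace $V$; $\Pi_H$ is the identity on $H$, and $\lambda-Q(\Pi_H-\Pi_U)$ means $\lambda\Pi_H-Q(\Pi_H-\Pi_U)$. $\mathrm{N}(\xi,\sigma^2Q)$ is the Gaussian measure on $H$ with mean $\xi$ and covariance operator $\sigma^2Q$, i.e. if $Y$ has this law then $\langle b,Y\rangle\sim\mathrm{N}(\langle b,\xi\rangle,\sigma^2\langle Qb,b\rangle)$ (possibly degenerate) for all $b\in H$. $Y$ is the $H$-valued observation (the identity map on $H$). For $a\in(0,1)$, $\mathrm{F}_{m,n,a}$ is the $a$-quantile of the Fisher distribution $\mathrm{F}_{m,n}$ with $m$ and $n$ degrees of freedom. $\mathbf{1}$ denotes the indicator. The test $\delta(Y)$ has level of significance $\alpha$ if its expectation under $\mathbb{Q}_\gamma$ is at most $\alpha$ for all $\gamma\in\Gamma_0:=G_0\times(0,\infty)$. *)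

theory Defs
  imports "HOL-Probability.Probability"
begin

text \<open>
  A separable real Hilbert space is a type of sort
  \<open>{real_inner, banach, second_countable_topology}\<close>; for metric spaces second countability
  is equivalent to separability.
\<close>

text \<open>
  The closure only serves to make the projection meaningful for every linear subspace; if \<open>V\<close> is
  a closed subspace of a Hilbert space, then \<open>closure V = V\<close> and this is the usual orthogonal
  projection onto \<open>V\<close>.
\<close>

definition orth_proj :: "'a::real_inner set \<Rightarrow> 'a \<Rightarrow> 'a" where
  "orth_proj V x = (THE p. p \<in> closure V \<and> (\<forall>v\<in>V. inner (x - p) v = 0))"

definition self_adjoint :: "('a::real_inner \<Rightarrow> 'a) \<Rightarrow> bool" where
  "self_adjoint T \<longleftrightarrow> (\<forall>x y. inner (T x) y = inner x (T y))"

definition nonneg_operator :: "('a::real_inner \<Rightarrow> 'a) \<Rightarrow> bool" where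
  "nonneg_operator T \<longleftrightarrow> (\<forall>x. 0 \<le> inner (T x) x)"

definition nuclear :: "('a::real_normed_vector \<Rightarrow> 'b::real_normed_vector) \<Rightarrow> bool" where
  "nuclear T \<longleftrightarrow>
     (\<exists>(\<phi> :: nat \<Rightarrow> 'a \<Rightarrow>\<^sub>L real) (b :: nat \<Rightarrow> 'b).
        summable (\<lambda>k. norm (\<phi> k) * norm (b k)) \<and>
        (\<forall>x. (\<lambda>k. blinfun_apply (\<phi> k) x *\<^sub>R b k) sums T x))"

definition invariant_under :: "('a \<Rightarrow> 'a) \<Rightarrow> 'a set \<Rightarrow> bool" where
  "invariant_under T V \<longleftrightarrow> T ` V \<subseteq> V"

definition finite_dimensional :: "'a::real_vector set \<Rightarrow> bool" where
  "finite_dimensional V \<longleftrightarrow> (\<exists>B. finite B \<and> V \<subseteq> span B)"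

text \<open>The second parameter is the variance, not the standard deviation.\<close>

definition normal_law :: "real \<Rightarrow> real \<Rightarrow> real measure" where
  "normal_law \<mu> v =
     (if v = 0 then return borel \<mu> else density lborel (normal_density \<mu> (sqrt v)))"

text \<open>\<open>is_gaussian M \<xi> C\<close> says that \<open>M\<close> is the measure \<open>N(\<xi>, C)\<close>.\<close>

definition is_gaussian :: "'a::real_inner measure \<Rightarrow> 'a \<Rightarrow> ('a \<Rightarrow> 'a) \<Rightarrow> bool" where
  "is_gaussian M \<xi> C \<longleftrightarrow>
     prob_space M \<and> sets M = sets borel \<and>
     (\<forall>b. distr M borel (\<lambda>y. inner b y) = normal_law (inner b \<xi>) (inner (C b) b))"

definition chi_square_distribution :: "nat \<Rightarrow> real measure" where
  "chi_square_distribution k =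
     distr (Pi\<^sub>M {..<k} (\<lambda>_. std_normal_distribution)) borel (\<lambda>x. \<Sum>i<k. (x i)\<^sup>2)"

definition fisher_distribution :: "nat \<Rightarrow> nat \<Rightarrow> real measure" where
  "fisher_distribution m n =
     distr (chi_square_distribution m \<Otimes>\<^sub>M chi_square_distribution n) borel
       (\<lambda>(x, y). (x / real m) / (y / real n))"

definition quantile :: "real measure \<Rightarrow> real \<Rightarrow> real" where
  "quantile M a = Inf {x. a \<le> cdf M x}"

text \<open>
  Integrability is demanded because the Bochner integral of a non-integrable function is \<open>0\<close>.
\<close>

definition has_level_of_significance ::
  "('p \<Rightarrow> 'y measure) \<Rightarrow> 'p set \<Rightarrow> ('y \<Rightarrow> real) \<Rightarrow> real \<Rightarrow> bool" where
  "has_level_of_significance P \<Gamma>\<^sub>0 \<delta> \<alpha> \<longleftrightarrow>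
     (\<forall>\<gamma>\<in>\<Gamma>\<^sub>0. integrable (P \<gamma>) \<delta> \<and> integral\<^sup>L (P \<gamma>) \<delta> \<le> \<alpha>)"

end

theory Submission
  imports Defs
begin

text \<open>
  Put \<open>P1 = \<Pi>_U - \<Pi>_U0\<close> and \<open>P2 = \<Pi>_H - \<Pi>_U\<close>, where \<open>\<Pi>_V\<close> is the orthogonal
  projection onto the closure of \<open>V\<close>. They are orthogonal projections with
  \<open>P1 P2 = 0\<close>; since \<open>Q\<close> maps \<open>U\<close> and \<open>U0\<close> into themselves and is
  self-adjoint, both commute with \<open>Q\<close>; and both annihilate the mean \<open>A \<beta>\<close> under the
  hypothesis, because \<open>A \<beta>\<close> lies in \<open>U0\<close>. (Membership and invariance pass from \<open>U\<close> and
  \<open>U0\<close> to their closures.)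

  The statistic compares \<open>\<parallel>P1 Y\<parallel>\<^sup>2\<close> with \<open>\<parallel>P2 Y\<parallel>\<^sup>2\<close>. A full
  diagonalization of \<open>Q\<close> would turn them into weighted sums of independent chi-square variables, the
  weights being the eigenvalues of \<open>Q P1\<close> (all at most \<open>\<mu>\<close>) and of
  \<open>Q P2\<close> (with \<open>\<lambda>\<close> occurring \<open>n\<close> times). Less is enough:

  \<^item> Choose \<open>f_1, \<dots>, f_m\<close> in the range of \<open>Q P1\<close>, orthonormal for the form
    \<open>\<langle>Q x, y\<rangle>\<close>, which is positive definite there. The variables
    \<open>\<langle>f_i, Y\<rangle> / \<sigma>\<close> are independent standard normal and
    \<open>P1 Y = \<Sum> \<langle>f_i, Y\<rangle> Q f_i\<close> almost surely, since the difference of the two sides is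
    a Gaussian vector with zero covariance. The inequality
    \<open>\<parallel>T w\<parallel>\<^sup>2 \<le> \<parallel>T\<parallel> \<langle>T w, w\<rangle>\<close> for nonnegative \<open>T\<close> then gives
    \<open>\<parallel>P1 Y\<parallel>\<^sup>2 \<le> \<mu> \<sigma>\<^sup>2 \<chi>\<^sup>2_m\<close>.

  \<^item> Choose an orthonormal basis \<open>e_1, \<dots>, e_n\<close> of the eigenspace of \<open>Q P2\<close> for
    \<open>\<lambda>\<close>. Bessel's inequality gives
    \<open>\<parallel>P2 Y\<parallel>\<^sup>2 \<ge> \<lambda> \<sigma>\<^sup>2 \<chi>\<^sup>2_n\<close>. That this eigenspace is nonzero
    and finite dimensional is where nuclearity of \<open>Q\<close> enters: it makes \<open>Q P2\<close> compact
    (\<open>onorm_is_eigenvalue\<close>) and bounds its trace (\<open>finite_dimensional_eigenspace\<close>).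

  Within each system the coordinates are uncorrelated by the choice of the basis, across the two systems
  because \<open>Q\<close> commutes with the projections and \<open>P1 P2 = 0\<close>. Hence they are independent: a
  Gaussian measure is given only through its one-dimensional marginals, so independence has to be read off the joint characteristic function
  (\<open>indep_vars_from_char\<close>). Consequently the statistic is almost surely at most a variable with
  the Fisher distribution (\<open>gaussian_fisher_test\<close>). As the Fisher distribution has no atoms, it
  reaches its \<open>(1 - \<alpha>)\<close>-quantile with probability at most \<open>\<alpha>\<close>
  (\<open>quantile_tail\<close>).
\<close>

section \<open>Orthogonal projections in a Hilbert space\<close>

lemma subspace_closure:
  fixes V :: "'a::real_normed_vector set"
  assumes V: "subspace V"
  shows "subspace (closure V)"
proof (rule subspaceI)
  show "0 \<in> closure V" using subspace_0[OF V] closure_subset by blast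
next
  fix x y assume "x \<in> closure V" "y \<in> closure V"
  then obtain f g where "\<And>k. f k \<in> V" "f \<longlonglongrightarrow> x" "\<And>k. g k \<in> V" "g \<longlonglongrightarrow> y"
    unfolding closure_sequential by blast
  then show "x + y \<in> closure V" unfolding closure_sequential
    by (intro exI[of _ "\<lambda>k. f k + g k"]) (auto intro: subspace_add[OF V] tendsto_add)
next
  fix c x assume "x \<in> closure V"
  then obtain f where "\<And>k. f k \<in> V" "f \<longlonglongrightarrow> x"
    unfolding closure_sequential by blast
  then show "c *\<^sub>R x \<in> closure V" unfolding closure_sequential
    by (intro exI[of _ "\<lambda>k. c *\<^sub>R f k"]) (auto intro: subspace_scale[OF V] tendsto_scaleR)
qed

text \<open>
  A minimizing sequence for the distance from \<open>x\<close> to \<open>V\<close> is Cauchy by the parallelogram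
  law; its limit is the foot of the perpendicular, since moving it along any \<open>w\<close> in \<open>V\<close>
  does not decrease the distance to \<open>x\<close>.
\<close>

lemma orth_decomposition_exists:
  fixes V :: "'a::{real_inner,banach} set"
  assumes V: "subspace V"
  shows "\<exists>p \<in> closure V. \<forall>v\<in>V. inner (x - p) v = 0"
proof -
  define d where "d = infdist x V"
  have V0: "V \<noteq> {}" using subspace_0[OF V] by blast
  have "\<exists>v\<in>V. dist x v < d + 1 / real (Suc k)" for k
  proof (rule ccontr)
    assume "\<not> ?thesis"
    then have "d + 1 / real (Suc k) \<le> dist x v" if "v \<in> V" for v
      using that by (auto simp: not_less)
    then have "d + 1 / real (Suc k) \<le> infdist x V"
      unfolding infdist_notempty[OF V0] using V0 by (intro cINF_greatest) auto
    then show False by (simp add: d_def)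
  qed
  then obtain v where v: "\<And>k. v k \<in> V" "\<And>k. dist x (v k) < d + 1 / real (Suc k)"
    by metis
  have d0: "0 \<le> d" by (simp add: d_def infdist_nonneg)
  have mid: "d \<le> norm (x - (1/2) *\<^sub>R (v j + v k))" for j k
  proof -
    have "(1/2) *\<^sub>R (v j + v k) \<in> V"
      using v(1) V by (simp add: subspace_add subspace_scale)
    from infdist_le[OF this, of x] show ?thesis by (simp add: d_def dist_norm)
  qed
  have par: "(norm (v j - v k))\<^sup>2 = 2 * (norm (x - v j))\<^sup>2 + 2 * (norm (x - v k))\<^sup>2
      - 4 * (norm (x - (1/2) *\<^sub>R (v j + v k)))\<^sup>2" for j k
    unfolding power2_norm_eq_inner
    by (simp add: inner_diff_left inner_diff_right inner_add_left inner_add_right inner_commute algebra_simps)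
  have bound: "(norm (v j - v k))\<^sup>2 \<le> (8 * d + 4) / real (Suc N)" if "N \<le> j" "N \<le> k" for N j k
  proof -
    define e where "e = 1 / real (Suc N)"
    have e: "0 < e" "e \<le> 1" by (auto simp: e_def)
    have near: "(norm (x - v i))\<^sup>2 \<le> d\<^sup>2 + (2 * d + 1) * e" if "N \<le> i" for i
    proof -
      have "norm (x - v i) \<le> d + e"
        using v(2)[of i] that unfolding e_def dist_norm
        by (smt (verit) frac_le of_nat_0_less_iff of_nat_mono Suc_le_mono zero_less_Suc)
      then have "(norm (x - v i))\<^sup>2 \<le> (d + e)\<^sup>2" by (simp add: power_mono)
      also have "\<dots> = d\<^sup>2 + 2 * d * e + e * e" by (simp add: power2_eq_square algebra_simps)
      also have "\<dots> \<le> d\<^sup>2 + (2 * d + 1) * e"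
        using e mult_left_le[of e e] by (simp add: algebra_simps)
      finally show ?thesis .
    qed
    have "d\<^sup>2 \<le> (norm (x - (1/2) *\<^sub>R (v j + v k)))\<^sup>2" using mid d0 by (rule power_mono)
    with near[OF that(1)] near[OF that(2)] par[of j k]
    have "(norm (v j - v k))\<^sup>2 \<le> 4 * ((2 * d + 1) * e)" by linarith
    then show ?thesis by (simp add: e_def algebra_simps add_divide_distrib)
  qed
  have "Cauchy v"
  proof (rule CauchyI)
    fix e :: real assume "0 < e"
    then obtain N where N: "(8 * d + 4) / e\<^sup>2 < real N" using reals_Archimedean2 by blast
    have "(8 * d + 4) < real (Suc N) * e\<^sup>2" using N \<open>0 < e\<close>
      by (simp add: field_simps) (smt (verit) zero_less_power)
    then have "(8 * d + 4) / real (Suc N) < e\<^sup>2" by (simp add: field_simps)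
    then have "norm (v j - v k) < e" if "N \<le> j" "N \<le> k" for j k
      using bound[OF that] \<open>0 < e\<close> by (meson le_less_trans less_imp_le power_less_imp_less_base)
    then show "\<exists>M. \<forall>m\<ge>M. \<forall>n\<ge>M. norm (v m - v n) < e" by blast
  qed
  then obtain p where p: "v \<longlonglongrightarrow> p" by (meson Cauchy_convergent convergent_def)
  have pV: "p \<in> closure V" using v(1) p closure_sequential by blast
  have "norm (x - p) \<le> d"
  proof (rule LIMSEQ_le)
    show "(\<lambda>k. norm (x - v k)) \<longlonglongrightarrow> norm (x - p)" by (intro tendsto_intros p)
    show "(\<lambda>k. d + 1 / real (Suc k)) \<longlonglongrightarrow> d"
      using tendsto_add[OF tendsto_const[of d] LIMSEQ_Suc[OF lim_1_over_n]] by simp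
    show "\<exists>N. \<forall>n\<ge>N. norm (x - v n) \<le> d + 1 / real (Suc n)"
      using v(2) by (auto simp: dist_norm intro: less_imp_le)
  qed
  moreover have "d \<le> norm (x - q)" if "q \<in> closure V" for q
  proof -
    have "closed {q. d \<le> norm (x - q)}" by (intro closed_Collect_le continuous_intros)
    moreover have "V \<subseteq> {q. d \<le> norm (x - q)}"
      using infdist_le[of _ V x] by (auto simp: d_def dist_norm)
    ultimately show ?thesis using that closure_minimal by blast
  qed
  ultimately have min: "(norm (x - p))\<^sup>2 \<le> (norm (x - q))\<^sup>2" if "q \<in> closure V" for q
    using that by (meson norm_ge_zero order_trans power_mono)
  have "inner (x - p) w = 0" if w: "w \<in> V" for w
  proof (cases "w = 0")
    case False
    \<comment> \<open>The step that minimizes the quadratic function \<open>t \<mapsto> \<parallel>x - p - t w\<parallel>\<^sup>2\<close>.\<close>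
    define t where "t = inner (x - p) w / inner w w"
    have ww: "inner w w > 0" using False by simp
    have "p + t *\<^sub>R w \<in> closure V"
      using pV w closure_subset V by (meson subsetD subspace_closure subspace_add subspace_scale)
    from min[OF this] have "0 \<le> - 2 * t * inner (x - p) w + t\<^sup>2 * inner w w"
      unfolding power2_norm_eq_inner
      by (simp add: inner_diff_left inner_diff_right inner_add_left inner_add_right inner_commute power2_eq_square algebra_simps)
    also have "\<dots> = - ((inner (x - p) w)\<^sup>2 / inner w w)"
      using ww by (simp add: t_def power2_eq_square field_simps)
    finally have "(inner (x - p) w)\<^sup>2 / inner w w \<le> 0" by simp
    then show ?thesis using ww by (simp add: divide_le_0_iff)
  qed simp
  then show ?thesis using pV by blast
qed

lemma orthogonal_closure:
  assumes "\<forall>v\<in>V. inner y v = 0" "w \<in> closure V"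
  shows "inner y w = 0"
proof -
  have "closed {w. inner y w = 0}" by (intro closed_Collect_eq continuous_intros)
  moreover have "V \<subseteq> {w. inner y w = 0}" using assms(1) by blast
  ultimately show ?thesis using assms(2) closure_minimal by blast
qed

lemma orth_proj_eqI:
  assumes V: "subspace V" and p: "p \<in> closure V" "\<And>v. v \<in> V \<Longrightarrow> inner (x - p) v = 0"
  shows "orth_proj V x = p"
  unfolding orth_proj_def
proof (rule the_equality)
  fix q assume q: "q \<in> closure V \<and> (\<forall>v\<in>V. inner (x - q) v = 0)"
  have "q - p \<in> closure V" using q p V by (simp add: subspace_closure subspace_diff)
  moreover have "\<forall>v\<in>V. inner (q - p) v = 0"
    using q p(2) by (simp add: inner_diff_left)
  ultimately have "inner (q - p) (q - p) = 0" using orthogonal_closure by blast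
  then show "q = p" by simp
qed (use p in auto)

context
  fixes V :: "'a::{real_inner,banach} set"
  assumes V: "subspace V"
begin

lemma orth_proj_in_closure: "orth_proj V x \<in> closure V"
  and orth_proj_residual: "w \<in> closure V \<Longrightarrow> inner (x - orth_proj V x) w = 0"
proof -
  obtain p where p: "p \<in> closure V" "\<forall>v\<in>V. inner (x - p) v = 0"
    using orth_decomposition_exists[OF V] by blast
  then have eq: "orth_proj V x = p" using orth_proj_eqI[OF V] by blast
  show "orth_proj V x \<in> closure V" using p eq by simp
  show "inner (x - orth_proj V x) w = 0" if "w \<in> closure V"
    using orthogonal_closure p(2) that eq by blast
qed

lemma orth_proj_fixes: "x \<in> closure V \<Longrightarrow> orth_proj V x = x"
  by (rule orth_proj_eqI[OF V]) auto

lemma bounded_linear_orth_proj: "bounded_linear (orth_proj V)"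
proof (rule bounded_linear_intro[where K = 1])
  fix x y and r :: real
  have C: "subspace (closure V)" using V by (rule subspace_closure)
  show "orth_proj V (x + y) = orth_proj V x + orth_proj V y"
  proof (rule orth_proj_eqI[OF V])
    fix v assume "v \<in> V"
    then have v: "v \<in> closure V" using closure_subset by blast
    have "inner (x + y - (orth_proj V x + orth_proj V y)) v =
        inner (x - orth_proj V x) v + inner (y - orth_proj V y) v"
      by (simp add: inner_diff_left inner_add_left)
    then show "inner (x + y - (orth_proj V x + orth_proj V y)) v = 0"
      using orth_proj_residual[OF v] by simp
  qed (use C orth_proj_in_closure subspace_add in blast)
  show "orth_proj V (r *\<^sub>R x) = r *\<^sub>R orth_proj V x"
  proof (rule orth_proj_eqI[OF V])
    fix v assume "v \<in> V"
    then have v: "v \<in> closure V" using closure_subset by blast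
    have "inner (r *\<^sub>R x - r *\<^sub>R orth_proj V x) v = r * inner (x - orth_proj V x) v"
      by (simp add: inner_diff_left algebra_simps)
    then show "inner (r *\<^sub>R x - r *\<^sub>R orth_proj V x) v = 0"
      using orth_proj_residual[OF v] by simp
  qed (use C orth_proj_in_closure subspace_scale in blast)
  have "inner (orth_proj V x) (orth_proj V x) = inner x (orth_proj V x)"
    using orth_proj_residual[OF orth_proj_in_closure, of x x] by (simp add: inner_diff_left)
  also have "\<dots> \<le> norm x * norm (orth_proj V x)" by (rule norm_cauchy_schwarz)
  finally show "norm (orth_proj V x) \<le> norm x * 1"
    by (cases "orth_proj V x = 0") (auto simp: power2_norm_eq_inner[symmetric] power2_eq_square)
qed

lemma self_adjoint_orth_proj: "self_adjoint (orth_proj V)"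
  unfolding self_adjoint_def
proof (intro allI)
  fix x y
  have "inner (orth_proj V x) y = inner (orth_proj V x) (orth_proj V y)"
    using orth_proj_residual[OF orth_proj_in_closure, of y x]
    by (simp add: inner_diff_left inner_diff_right inner_commute)
  also have "\<dots> = inner x (orth_proj V y)"
    using orth_proj_residual[OF orth_proj_in_closure, of x y] by (simp add: inner_diff_left)
  finally show "inner (orth_proj V x) y = inner x (orth_proj V y)" .
qed

text \<open>
  Self-adjointness carries the invariance of \<open>V\<close> over to the orthogonal complement, and continuity
  carries it over to the closure; so applying \<open>Q\<close> to the decomposition of \<open>x\<close> gives that of
  \<open>Q x\<close>.
\<close>

lemma orth_proj_commutes:
  assumes Q: "bounded_linear Q" "self_adjoint Q" and inv: "invariant_under Q V"
  shows "orth_proj V (Q x) = Q (orth_proj V x)"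
proof (rule orth_proj_eqI[OF V])
  interpret bounded_linear Q by fact
  have "Q ` closure V \<subseteq> closure (Q ` V)"
    by (intro image_closure_subset continuous_on closure_subset closed_closure continuous_on_id)
  also have "\<dots> \<subseteq> closure V"
    using inv by (intro closure_mono) (simp add: invariant_under_def)
  finally show "Q (orth_proj V x) \<in> closure V" using orth_proj_in_closure by blast
  fix v assume v: "v \<in> V"
  then have "Q v \<in> closure V" using inv closure_subset by (auto simp: invariant_under_def)
  have "inner (Q x - Q (orth_proj V x)) v = inner (x - orth_proj V x) (Q v)"
    using Q(2) by (simp add: self_adjoint_def flip: diff)
  then show "inner (Q x - Q (orth_proj V x)) v = 0"
    using orth_proj_residual[OF \<open>Q v \<in> closure V\<close>] by simp
qed

end

lemma orth_proj_comp_subspace: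
  fixes V W :: "'a::{real_inner,banach} set"
  assumes V: "subspace V" and W: "subspace W" and sub: "V \<subseteq> W"
  shows "orth_proj W (orth_proj V x) = orth_proj V x"
    and "orth_proj V (orth_proj W x) = orth_proj V x"
proof -
  show "orth_proj W (orth_proj V x) = orth_proj V x"
    using orth_proj_in_closure[OF V] closure_mono[OF sub] by (intro orth_proj_fixes[OF W]) blast
  show "orth_proj V (orth_proj W x) = orth_proj V x"
  proof (rule orth_proj_eqI[OF V orth_proj_in_closure[OF V]])
    fix u assume "u \<in> V"
    then have "inner (x - orth_proj V x) u = 0" "inner (x - orth_proj W x) u = 0"
      using sub closure_subset orth_proj_residual[OF V] orth_proj_residual[OF W] by blast+
    then show "inner (orth_proj W x - orth_proj V x) u = 0" by (simp add: inner_diff_left)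
  qed
qed

section \<open>Orthonormal systems for bilinear forms\<close>

text \<open>
  Gram-Schmidt for an arbitrary form that is definite on the span. It serves both the inner product, on the
  eigenspace for \<open>\<lambda>\<close>, and the covariance form \<open>\<langle>Q x, y\<rangle>\<close>, on the range of
  \<open>Q P1\<close>. The spanning set \<open>C\<close> may be dependent, so the number \<open>k\<close> of vectors is
  part of the conclusion.
\<close>

lemma orthonormal_basis_of_form:
  fixes B :: "'a::real_vector \<Rightarrow> 'a \<Rightarrow> real"
  assumes lin: "\<And>y. linear (\<lambda>x. B x y)" and sym: "\<And>x y. B x y = B y x"
    and C: "finite C" and pos: "\<And>x. x \<in> span C \<Longrightarrow> x \<noteq> 0 \<Longrightarrow> 0 < B x x"
  shows "\<exists>(f :: nat \<Rightarrow> 'a) k. (\<forall>i<k. \<forall>j<k. B (f i) (f j) = (if i = j then 1 else 0)) \<and>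
    span (f ` {..<k}) = span C"
  using C pos
proof (induction C)
  case empty
  show ?case by (intro exI[of _ "\<lambda>_. 0"] exI[of _ 0]) auto
next
  case (insert c C)
  have "span C \<subseteq> span (insert c C)" by (intro span_mono) auto
  with insert obtain f :: "nat \<Rightarrow> 'a" and k
    where on: "\<And>i j. i < k \<Longrightarrow> j < k \<Longrightarrow> B (f i) (f j) = (if i = j then 1 else 0)"
      and sp: "span (f ` {..<k}) = span C"
    by (metis (no_types, lifting) subsetD)
  have spi: "span (insert x (f ` {..<k})) = span (insert x C)" for x
    unfolding span_insert sp ..
  define s where "s = (\<Sum>i<k. B c (f i) *\<^sub>R f i)"
  have s: "s \<in> span C" unfolding s_def sp[symmetric]
    by (intro span_sum span_scale span_base) auto
  define r where "r = c - s"
  have r0: "B r (f j) = 0" if "j < k" for j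
  proof -
    have "B s (f j) = (\<Sum>i<k. B c (f i) * B (f i) (f j))"
      by (simp add: s_def linear_sum[OF lin] linear_scale[OF lin])
    also have "\<dots> = (\<Sum>i<k. if i = j then B c (f j) else 0)"
      using that by (intro sum.cong) (auto simp: on)
    finally show ?thesis using that by (simp add: r_def linear_diff[OF lin])
  qed
  show ?case
  proof (cases "r = 0")
    case True
    then have "span (insert c C) = span C" using s by (simp add: r_def span_redundant)
    then show ?thesis using on sp by (intro exI[of _ f] exI[of _ k]) auto
  next
    case False
    have rs: "r \<in> span (insert c C)"
      unfolding r_def using s by (meson \<open>span C \<subseteq> span (insert c C)\<close> insertI1 span_base span_diff subsetD)
    then have rr: "0 < B r r" using False insert.prems by blast
    define u where "u = (1 / sqrt (B r r)) *\<^sub>R r"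
    have Bscale: "B x (a *\<^sub>R y) = a * B x y" for x y a
      using linear_scale[OF lin] sym by (metis real_scaleR_def)
    have Bscale': "B (a *\<^sub>R x) y = a * B x y" for x y a
      using linear_scale[OF lin] by (metis real_scaleR_def)
    have uu: "B u u = 1" using rr by (simp add: u_def Bscale Bscale' field_simps flip: power2_eq_square)
    have uf: "B u (f j) = 0" "B (f j) u = 0" if "j < k" for j
      using r0[OF that] sym[of "f j" r] by (auto simp: u_def Bscale Bscale')
    define g where "g = f(k := u)"
    have "span (g ` {..<Suc k}) = span (insert u (f ` {..<k}))"
      by (rule arg_cong[where f = span]) (auto simp: g_def lessThan_Suc)
    also have "\<dots> = span (insert u C)" by (rule spi)
    also have "\<dots> = span (insert c C)"
    proof (rule span_eq[THEN iffD2, OF conjI])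
      show "insert u C \<subseteq> span (insert c C)"
        using rs by (auto simp: u_def intro: span_scale span_base)
      have "r = sqrt (B r r) *\<^sub>R u" using rr by (simp add: u_def)
      then have "r \<in> span (insert u C)" by (metis insertI1 span_base span_scale)
      moreover have "s \<in> span (insert u C)" using s by (meson span_mono subsetD subset_insertI)
      ultimately have "c \<in> span (insert u C)" unfolding r_def by (metis diff_add_cancel span_add)
      then show "insert c C \<subseteq> span (insert u C)" by (auto intro: span_base)
    qed
    finally have "span (g ` {..<Suc k}) = span (insert c C)" .
    moreover have "\<forall>i<Suc k. \<forall>j<Suc k. B (g i) (g j) = (if i = j then 1 else 0)"
      using on uu uf by (auto simp: g_def less_Suc_eq)
    ultimately show ?thesis by blast
  qed
qed

lemma orthonormal_sum:
  fixes B :: "'a::real_vector \<Rightarrow> 'a \<Rightarrow> real" and f :: "nat \<Rightarrow> 'a"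
  assumes lin: "\<And>y. linear (\<lambda>x. B x y)"
    and on: "\<forall>i<k. \<forall>j<k. B (f i) (f j) = (if i = j then 1 else 0)" and j: "j < k"
  shows "B (\<Sum>i<k. a i *\<^sub>R f i) (f j) = a j"
proof -
  have "B (\<Sum>i<k. a i *\<^sub>R f i) (f j) = (\<Sum>i<k. a i * B (f i) (f j))"
    by (simp add: linear_sum[OF lin] linear_scale[OF lin])
  also have "\<dots> = (\<Sum>i<k. if i = j then a j else 0)"
    using j on by (intro sum.cong) auto
  finally show ?thesis using j by simp
qed

lemma span_image_lessThan:
  fixes f :: "nat \<Rightarrow> 'a::real_vector"
  assumes "x \<in> span (f ` {..<k})"
  obtains a where "x = (\<Sum>i<k. a i *\<^sub>R f i)"
proof -
  have "\<exists>a. x = (\<Sum>i<k. a i *\<^sub>R f i)"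
    using assms
  proof (induction rule: span_induct_alt)
    case base
    show ?case by (rule exI[of _ "\<lambda>_. 0"]) simp
  next
    case (step c y z)
    then obtain a j where a: "z = (\<Sum>i<k. a i *\<^sub>R f i)" and j: "j < k" "y = f j" by blast
    have "c *\<^sub>R y = (\<Sum>i<k. if i = j then c *\<^sub>R f i else 0)" using j by simp
    then have "c *\<^sub>R y + z = (\<Sum>i<k. (if i = j then c *\<^sub>R f i else 0) + a i *\<^sub>R f i)"
      by (simp add: a sum.distrib)
    also have "\<dots> = (\<Sum>i<k. ((if i = j then c else 0) + a i) *\<^sub>R f i)"
      by (intro sum.cong) (auto simp: scaleR_add_left)
    finally show ?case by (intro exI[of _ "\<lambda>i. (if i = j then c else 0) + a i"])
  qed
  then show thesis using that by blast
qed

lemma dim_span_orthonormal: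
  fixes B :: "'a::real_vector \<Rightarrow> 'a \<Rightarrow> real" and f :: "nat \<Rightarrow> 'a"
  assumes lin: "\<And>y. linear (\<lambda>x. B x y)"
    and on: "\<forall>i<k. \<forall>j<k. B (f i) (f j) = (if i = j then 1 else 0)"
  shows "dim (span (f ` {..<k})) = k"
proof -
  have inj: "inj_on f {..<k}"
  proof (rule inj_onI)
    fix i j assume "i \<in> {..<k}" "j \<in> {..<k}" "f i = f j"
    then show "i = j" using on by (metis lessThan_iff zero_neq_one)
  qed
  have "independent (f ` {..<k})"
  proof (rule independent_if_scalars_zero)
    fix c x assume c: "(\<Sum>x\<in>f ` {..<k}. c x *\<^sub>R x) = 0" and x: "x \<in> f ` {..<k}"
    then obtain j where j: "j < k" "x = f j" by blast
    have "(\<Sum>i<k. c (f i) *\<^sub>R f i) = 0" using c by (simp add: sum.reindex[OF inj])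
    then show "c x = 0"
      using orthonormal_sum[OF lin on j(1), of "\<lambda>i. c (f i)"] linear_0[OF lin] j by simp
  qed simp
  then show ?thesis using inj by (simp add: dim_eq_card_independent card_image)
qed

text \<open>
  An infinite basis would contain an independent set of \<open>N + 1\<close> vectors, which Gram-Schmidt turns
  into an orthonormal system that is too long.
\<close>

lemma finite_span_if_orthonormal_bounded:
  fixes V :: "'a::real_inner set"
  assumes V: "subspace V"
    and N: "\<And>(e :: nat \<Rightarrow> 'a) k. \<lbrakk>\<forall>i<k. e i \<in> V;
      \<forall>i<k. \<forall>j<k. inner (e i) (e j) = (if i = j then 1 else 0)\<rbrakk> \<Longrightarrow> k \<le> N"
  shows "\<exists>C. finite C \<and> V = span C"
proof -
  obtain C where C: "C \<subseteq> V" "independent C" "V \<subseteq> span C" by (rule basis_exists)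
  have "finite C"
  proof (rule ccontr)
    assume "infinite C"
    then obtain D where D: "finite D" "card D = Suc N" "D \<subseteq> C"
      using infinite_arbitrarily_large by blast
    have lin: "linear (\<lambda>x. inner x y)" for y :: 'a
      by (simp add: bounded_linear.linear bounded_linear_inner_left)
    have "\<exists>(f :: nat \<Rightarrow> 'a) k. (\<forall>i<k. \<forall>j<k. inner (f i) (f j) = (if i = j then 1 else 0)) \<and>
        span (f ` {..<k}) = span D"
      by (rule orthonormal_basis_of_form[OF lin inner_commute D(1)]) simp
    then obtain f :: "nat \<Rightarrow> 'a" and k
      where on: "\<forall>i<k. \<forall>j<k. inner (f i) (f j) = (if i = j then 1 else 0)"
        and sp: "span (f ` {..<k}) = span D" by blast
    have "independent D" using C(2) D(3) by (rule independent_mono)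
    then have "k = Suc N"
      using dim_span_orthonormal[OF lin on] D(2) by (simp add: sp dim_eq_card_independent)
    moreover have "f i \<in> V" if "i < k" for i
    proof -
      have "f i \<in> span D" unfolding sp[symmetric] using that by (auto intro: span_base)
      also have "span D \<subseteq> V" using C(1) D(3) V by (intro span_minimal) auto
      finally show ?thesis .
    qed
    ultimately show False using N[OF _ on] by fastforce
  qed
  moreover have "V = span C" using C V by (meson span_minimal subset_antisym)
  ultimately show ?thesis by blast
qed

lemma Bessel:
  fixes e :: "nat \<Rightarrow> 'a::real_inner"
  assumes on: "\<forall>i<k. \<forall>j<k. inner (e i) (e j) = (if i = j then 1 else 0)"
  shows "(norm (\<Sum>i<k. inner x (e i) *\<^sub>R e i))\<^sup>2 = (\<Sum>i<k. (inner x (e i))\<^sup>2)" (is "(norm ?s)\<^sup>2 = ?S")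
    and "(\<Sum>i<k. (inner x (e i))\<^sup>2) \<le> (norm x)\<^sup>2"
proof -
  have lin: "linear (\<lambda>x. inner x y)" for y :: 'a
    by (simp add: bounded_linear.linear bounded_linear_inner_left)
  have xs: "inner x ?s = ?S" by (simp add: inner_sum_right power2_eq_square)
  have "inner ?s ?s = (\<Sum>j<k. inner x (e j) * inner ?s (e j))" by (simp add: inner_sum_right)
  also have "\<dots> = ?S"
    using orthonormal_sum[of inner, OF lin on] by (simp add: power2_eq_square)
  finally have ss: "inner ?s ?s = ?S" .
  then show "(norm ?s)\<^sup>2 = ?S" by (simp add: power2_norm_eq_inner)
  have "0 \<le> inner (x - ?s) (x - ?s)" by simp
  also have "\<dots> = inner x x - ?S"
    using xs ss by (simp add: inner_diff_left inner_diff_right inner_commute[of ?s x])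
  finally show "?S \<le> (norm x)\<^sup>2" by (simp add: power2_norm_eq_inner)
qed

section \<open>Spectral properties of nuclear operators\<close>

text \<open>
  Write \<open>T x = \<Sum> \<phi>_k(x) b_k\<close>. On the unit ball the coefficient sequence ranges in the product of
  the intervals \<open>[-\<parallel>\<phi>_k\<parallel>, \<parallel>\<phi>_k\<parallel>]\<close>, which is compact by Tychonoff's theorem, and
  the series is a continuous function of the coefficients there, being a uniform limit.
\<close>

lemma nuclear_unit_ball_relatively_compact:
  fixes T :: "'a::real_normed_vector \<Rightarrow> 'b::banach"
  assumes "nuclear T"
  shows "\<exists>K. compact K \<and> T ` cball 0 1 \<subseteq> K"
proof -
  obtain \<phi> :: "nat \<Rightarrow> 'a \<Rightarrow>\<^sub>L real" and b :: "nat \<Rightarrow> 'b"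
    where sm: "summable (\<lambda>k. norm (\<phi> k) * norm (b k))"
      and T: "\<And>x. (\<lambda>k. blinfun_apply (\<phi> k) x *\<^sub>R b k) sums T x"
    using assms unfolding nuclear_def by blast
  define S where "S = (\<Pi>\<^sub>E k\<in>UNIV. {- norm (\<phi> k)..norm (\<phi> k)})"
  define g where "g c = (\<Sum>k. c k *\<^sub>R b k)" for c :: "nat \<Rightarrow> real"
  have "compactin (product_topology (\<lambda>_. euclidean) UNIV) S"
    unfolding S_def compactin_PiE by auto
  then have "compact S" by (simp add: euclidean_product_topology)
  moreover have "continuous_on S g"
  proof (rule uniform_limit_theorem)
    show "uniform_limit S (\<lambda>n c. \<Sum>k<n. c k *\<^sub>R b k) g sequentially"
      unfolding g_def
    proof (rule Weierstrass_m_test[OF _ sm])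
      fix k c assume "c \<in> S"
      then have "c k \<in> {- norm (\<phi> k)..norm (\<phi> k)}" by (auto simp: S_def PiE_iff)
      then have "\<bar>c k\<bar> \<le> norm (\<phi> k)" by auto
      then show "norm (c k *\<^sub>R b k) \<le> norm (\<phi> k) * norm (b k)"
        by (simp add: mult_right_mono)
    qed
    show "\<forall>\<^sub>F n in sequentially. continuous_on S (\<lambda>c. \<Sum>k<n. c k *\<^sub>R b k)"
      by (intro always_eventually allI continuous_intros continuous_on_product_coordinates
          continuous_on_subset[OF continuous_on_product_coordinates]) auto
  qed simp
  ultimately have "compact (g ` S)" by (simp add: compact_continuous_image)
  moreover have "T x \<in> g ` S" if "x \<in> cball 0 1" for x
  proof
    show "T x = g (\<lambda>k. blinfun_apply (\<phi> k) x)"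
      using T[of x] by (simp add: g_def sums_iff)
    have "\<bar>blinfun_apply (\<phi> k) x\<bar> \<le> norm (\<phi> k)" for k
    proof -
      have "norm (blinfun_apply (\<phi> k) x) \<le> norm (\<phi> k) * norm x" by (rule norm_blinfun)
      also have "\<dots> \<le> norm (\<phi> k)" using that by (simp add: mult_left_le)
      finally show ?thesis by simp
    qed
    then show "(\<lambda>k. blinfun_apply (\<phi> k) x) \<in> S"
      by (simp add: S_def PiE_iff abs_le_iff minus_le_iff)
  qed
  ultimately show ?thesis by blast
qed

lemma nuclear_compose:
  fixes T :: "'b::real_normed_vector \<Rightarrow> 'c::real_normed_vector" and L :: "'a::real_normed_vector \<Rightarrow> 'b"
  assumes "nuclear T" and L: "bounded_linear L"
  shows "nuclear (\<lambda>x. T (L x))"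
proof -
  obtain \<phi> :: "nat \<Rightarrow> 'b \<Rightarrow>\<^sub>L real" and b :: "nat \<Rightarrow> 'c"
    where sm: "summable (\<lambda>k. norm (\<phi> k) * norm (b k))"
      and T: "\<And>x. (\<lambda>k. blinfun_apply (\<phi> k) x *\<^sub>R b k) sums T x"
    using assms unfolding nuclear_def by blast
  define \<psi> where "\<psi> k = \<phi> k o\<^sub>L Blinfun L" for k
  have "summable (\<lambda>k. norm (\<psi> k) * norm (b k))"
  proof (rule summable_comparison_test')
    show "summable (\<lambda>k. norm (Blinfun L) * (norm (\<phi> k) * norm (b k)))"
      using sm by (rule summable_mult)
    show "norm (norm (\<psi> k) * norm (b k)) \<le> norm (Blinfun L) * (norm (\<phi> k) * norm (b k))" for k
      using mult_right_mono[OF norm_blinfun_compose[of "\<phi> k" "Blinfun L"], of "norm (b k)"]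
      by (simp add: \<psi>_def algebra_simps)
  qed
  moreover have "(\<lambda>k. blinfun_apply (\<psi> k) x *\<^sub>R b k) sums T (L x)" for x
    using T[of "L x"] by (simp add: \<psi>_def bounded_linear_Blinfun_apply[OF L])
  ultimately show ?thesis unfolding nuclear_def by blast
qed

text \<open>
  Term by term, \<open>\<Sum>_i \<phi>_j(e_i) \<langle>b_j, e_i\<rangle>\<close> is \<open>\<phi>_j\<close> applied to the
  projection of \<open>b_j\<close> onto the span of the \<open>e_i\<close>, so it is at most
  \<open>\<parallel>\<phi>_j\<parallel> \<parallel>b_j\<parallel>\<close>, independently of the orthonormal system.
\<close>

lemma nuclear_trace_bound:
  fixes T :: "'a::real_inner \<Rightarrow> 'a"
  assumes "nuclear T"
  shows "\<exists>C. \<forall>(e :: nat \<Rightarrow> 'a) k. (\<forall>i<k. \<forall>j<k. inner (e i) (e j) = (if i = j then 1 else 0)) \<longrightarrow>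
    (\<Sum>i<k. inner (T (e i)) (e i)) \<le> C"
proof -
  obtain \<phi> :: "nat \<Rightarrow> 'a \<Rightarrow>\<^sub>L real" and b :: "nat \<Rightarrow> 'a"
    where sm: "summable (\<lambda>k. norm (\<phi> k) * norm (b k))"
      and T: "\<And>x. (\<lambda>k. blinfun_apply (\<phi> k) x *\<^sub>R b k) sums T x"
    using assms unfolding nuclear_def by blast
  have "(\<Sum>i<k. inner (T (e i)) (e i)) \<le> (\<Sum>j. norm (\<phi> j) * norm (b j))"
    if on: "\<forall>i<k. \<forall>j<k. inner (e i) (e j) = (if i = j then 1 else 0)"
    for e :: "nat \<Rightarrow> 'a" and k
  proof (rule sums_le)
    show "(\<lambda>j. \<Sum>i<k. inner (blinfun_apply (\<phi> j) (e i) *\<^sub>R b j) (e i)) sums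
        (\<Sum>i<k. inner (T (e i)) (e i))"
      by (intro sums_sum bounded_linear.sums[OF bounded_linear_inner_left] T)
    show "(\<lambda>j. norm (\<phi> j) * norm (b j)) sums (\<Sum>j. norm (\<phi> j) * norm (b j))"
      using sm by (rule summable_sums)
    fix j
    let ?s = "\<Sum>i<k. inner (b j) (e i) *\<^sub>R e i"
    have "(\<Sum>i<k. inner (blinfun_apply (\<phi> j) (e i) *\<^sub>R b j) (e i)) = blinfun_apply (\<phi> j) ?s"
      by (simp add: blinfun.sum_right blinfun.scaleR_right mult.commute)
    also have "\<dots> \<le> norm (\<phi> j) * norm ?s" using norm_blinfun[of "\<phi> j" ?s] by simp
    also have "\<dots> \<le> norm (\<phi> j) * norm (b j)"
    proof (rule mult_left_mono)
      have "(norm ?s)\<^sup>2 \<le> (norm (b j))\<^sup>2" using Bessel[OF on, of "b j"] by simp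
      then show "norm ?s \<le> norm (b j)" by (rule power2_le_imp_le) simp
    qed simp
    finally show "(\<Sum>i<k. inner (blinfun_apply (\<phi> j) (e i) *\<^sub>R b j) (e i)) \<le> norm (\<phi> j) * norm (b j)" .
  qed
  then show ?thesis by blast
qed

text \<open>
  Each vector of an orthonormal system of eigenvectors contributes \<open>c\<close> to the trace, which is
  bounded.
\<close>

lemma finite_dimensional_eigenspace:
  fixes T :: "'a::real_inner \<Rightarrow> 'a"
  assumes T: "linear T" "nuclear T" and c: "0 < c"
  shows "\<exists>C. finite C \<and> {x. T x = c *\<^sub>R x} = span C"
proof -
  interpret linear T by fact
  obtain C where C: "\<And>(e :: nat \<Rightarrow> 'a) k. \<forall>i<k. \<forall>j<k. inner (e i) (e j) = (if i = j then 1 else 0) \<Longrightarrow>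
    (\<Sum>i<k. inner (T (e i)) (e i)) \<le> C"
    using nuclear_trace_bound[OF T(2)] by blast
  show ?thesis
  proof (rule finite_span_if_orthonormal_bounded[where N = "nat \<lfloor>C / c\<rfloor>"])
    show "subspace {x. T x = c *\<^sub>R x}"
      by (auto simp: subspace_def add scale scaleR_add_right)
    fix e :: "nat \<Rightarrow> 'a" and k
    assume e: "\<forall>i<k. e i \<in> {x. T x = c *\<^sub>R x}"
      and on: "\<forall>i<k. \<forall>j<k. inner (e i) (e j) = (if i = j then 1 else 0)"
    have "(\<Sum>i<k. inner (T (e i)) (e i)) = (\<Sum>i<k. c)" using e on by (intro sum.cong) auto
    then have "real k * c \<le> C" using C[OF on] by simp
    then have "real k \<le> C / c" using c by (simp add: field_simps)
    then show "k \<le> nat \<lfloor>C / c\<rfloor>" by (simp add: le_nat_floor)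
  qed
qed

lemma compression_self_adjoint_nonneg:
  fixes Q P :: "'a::real_inner \<Rightarrow> 'a"
  assumes Q: "bounded_linear Q" "self_adjoint Q" "nonneg_operator Q"
    and P: "bounded_linear P" "self_adjoint P" "\<And>x. P (P x) = P x" "\<And>x. P (Q x) = Q (P x)"
  shows "bounded_linear (\<lambda>x. Q (P x))" "self_adjoint (\<lambda>x. Q (P x))" "nonneg_operator (\<lambda>x. Q (P x))"
proof -
  have Qs: "inner (Q x) y = inner x (Q y)" for x y using Q(2) by (simp add: self_adjoint_def)
  have Ps: "inner (P x) y = inner x (P y)" for x y using P(2) by (simp add: self_adjoint_def)
  show "bounded_linear (\<lambda>x. Q (P x))" by (rule bounded_linear_compose[OF Q(1) P(1)])
  show "self_adjoint (\<lambda>x. Q (P x))" unfolding self_adjoint_def by (simp add: Qs Ps P(4))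
  have "inner (Q (P x)) x = inner (Q (P x)) (P x)" for x
    using Ps[of "Q (P x)" x] by (simp add: P)
  then show "nonneg_operator (\<lambda>x. Q (P x))" using Q(3) by (simp add: nonneg_operator_def)
qed

text \<open>
  Cauchy-Schwarz for the semidefinite form \<open>\<langle>T x, y\<rangle>\<close>, applied to \<open>x\<close> and
  \<open>T x\<close>. It replaces the eigenvalue expansion when the numerator of the statistic is bounded.
\<close>

lemma norm_sq_le_onorm_form:
  fixes T :: "'a::real_inner \<Rightarrow> 'a"
  assumes T: "bounded_linear T" "self_adjoint T" "nonneg_operator T"
  shows "(norm (T x))\<^sup>2 \<le> onorm T * inner (T x) x"
proof (cases "T x = 0")
  case False
  interpret bounded_linear T by fact
  define a where "a = inner (T x) x"
  define b where "b = inner (T x) (T x)"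
  define c where "c = inner (T (T x)) (T x)"
  have sa: "inner (T x) y = inner x (T y)" for x y using T(2) by (simp add: self_adjoint_def)
  have b: "0 < b" using False by (simp add: b_def)
  have quad: "0 \<le> a - 2 * t * b + t\<^sup>2 * c" for t
  proof -
    have "0 \<le> inner (T (x - t *\<^sub>R T x)) (x - t *\<^sub>R T x)" using T(3) by (simp add: nonneg_operator_def)
    also have "\<dots> = a - 2 * t * b + t\<^sup>2 * c"
      unfolding a_def b_def c_def
      by (simp add: diff scaleR inner_diff_left inner_diff_right sa[of "T x" x] power2_eq_square algebra_simps)
    finally show ?thesis .
  qed
  have "c \<le> norm (T (T x)) * norm (T x)" unfolding c_def by (rule norm_cauchy_schwarz)
  also have "\<dots> \<le> onorm T * norm (T x) * norm (T x)"
    by (intro mult_right_mono onorm[OF T(1)]) auto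
  finally have cb: "c \<le> onorm T * b" by (simp add: b_def dot_square_norm power2_eq_square mult.assoc)
  have L: "0 < onorm T" using False onorm_pos_lt[OF T(1)] by (metis)
  \<comment> \<open>\<open>t = 1 / \<parallel>T\<parallel>\<close> makes the quadratic bound collapse to \<open>b \<le> \<parallel>T\<parallel> a\<close>.\<close>
  have "0 \<le> a - 2 * (1 / onorm T) * b + (1 / onorm T)\<^sup>2 * c" by (rule quad)
  also have "\<dots> \<le> a - 2 * (1 / onorm T) * b + (1 / onorm T)\<^sup>2 * (onorm T * b)"
    by (intro add_left_mono mult_left_mono cb) auto
  also have "\<dots> = a - b / onorm T" using L by (simp add: power2_eq_square field_simps)
  finally have "b \<le> onorm T * a" using L by (simp add: field_simps)
  then show ?thesis by (simp add: a_def b_def power2_norm_eq_inner)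
qed (simp)

text \<open>
  Take unit vectors \<open>x_k\<close> with \<open>\<parallel>T x_k\<parallel> \<rightarrow> L = \<parallel>T\<parallel>\<close>. Then
  \<open>T\<^sup>2 x_k - L\<^sup>2 x_k \<rightarrow> 0\<close>, and by compactness \<open>T x_k\<close> converges along a
  subsequence; hence so do \<open>T\<^sup>2 x_k\<close> and \<open>x_k\<close>, and the limit is an eigenvector of
  \<open>T\<^sup>2\<close>.
\<close>

lemma onorm_is_eigenvalue:
  fixes T :: "'a::{real_inner,banach} \<Rightarrow> 'a"
  assumes T: "bounded_linear T" "self_adjoint T" "nonneg_operator T" "nuclear T" and nz: "T \<noteq> (\<lambda>x. 0)"
  shows "\<exists>x. x \<noteq> 0 \<and> T x = onorm T *\<^sub>R x"
proof -
  interpret bounded_linear T by fact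
  define L where "L = onorm T"
  obtain z where "T z \<noteq> 0" using nz by auto
  then have L: "0 < L" unfolding L_def using onorm_pos_lt[OF T(1)] by metis
  have sa: "inner (T x) y = inner x (T y)" for x y using T(2) by (simp add: self_adjoint_def)
  define c where "c k = L * (1 - 1 / real (Suc k))" for k
  have c: "0 \<le> c k" "c k < L" for k using L by (auto simp: c_def field_simps)
  have "\<exists>x. norm x = 1 \<and> c k < norm (T x)" for k
  proof -
    have "\<not> (\<forall>x. norm (T x) \<le> c k * norm x)"
      using onorm_bound[OF c(1), of T] c(2)[of k] by (auto simp: L_def not_le[symmetric])
    then obtain x where x: "c k * norm x < norm (T x)" by (auto simp: not_le)
    then have "x \<noteq> 0" using zero by auto
    then show ?thesis using x
      by (intro exI[of _ "x /\<^sub>R norm x"]) (auto simp: scaleR field_simps)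
  qed
  then obtain x where x: "\<And>k. norm (x k) = 1" "\<And>k. c k < norm (T (x k))" by metis
  obtain K where K: "compact K" "T ` cball 0 1 \<subseteq> K"
    using nuclear_unit_ball_relatively_compact[OF T(4)] by blast
  have "T (x k) \<in> K" for k using K(2) x(1) by auto
  then obtain l r where r: "strict_mono r" "((\<lambda>k. T (x k)) \<circ> r) \<longlonglongrightarrow> l"
    using K(1) unfolding compact_def by meson
  have Txr: "(\<lambda>k. T (x (r k))) \<longlonglongrightarrow> l" using r(2) by (simp add: o_def)
  have cr: "(\<lambda>k. c (r k)) \<longlonglongrightarrow> L"
  proof -
    have "c \<longlonglongrightarrow> L * (1 - 0)" unfolding c_def
      by (intro tendsto_intros LIMSEQ_Suc[OF lim_1_over_n])
    then show ?thesis using LIMSEQ_subseq_LIMSEQ[OF _ r(1)] by (force simp: o_def)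
  qed
  define w where "w k = T (T (x (r k))) - (L\<^sup>2) *\<^sub>R x (r k)" for k
  have w: "(norm (w k))\<^sup>2 \<le> 2 * L^4 - 2 * L\<^sup>2 * (c (r k))\<^sup>2" for k
  proof -
    let ?x = "x (r k)"
    have "(norm (w k))\<^sup>2 = (norm (T (T ?x)))\<^sup>2 - 2 * L\<^sup>2 * (norm (T ?x))\<^sup>2 + L^4 * (norm ?x)\<^sup>2"
      unfolding w_def power2_norm_eq_inner
      by (simp add: inner_diff_left inner_diff_right sa[of "T ?x" ?x] inner_commute[of ?x "T (T ?x)"] power2_eq_square power4_eq_xxxx algebra_simps)
    moreover have "norm (T (T ?x)) \<le> L\<^sup>2"
    proof -
      have "norm (T (T ?x)) \<le> L * norm (T ?x)" unfolding L_def by (rule onorm[OF T(1)])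
      also have "\<dots> \<le> L * (L * norm ?x)" using L unfolding L_def by (intro mult_left_mono onorm[OF T(1)]) auto
      finally show ?thesis by (simp add: x power2_eq_square)
    qed
    then have "(norm (T (T ?x)))\<^sup>2 \<le> (L\<^sup>2)\<^sup>2" by (intro power_mono) auto
    moreover have "(c (r k))\<^sup>2 \<le> (norm (T ?x))\<^sup>2" by (intro power_mono less_imp_le x c)
    then have "2 * L\<^sup>2 * (c (r k))\<^sup>2 \<le> 2 * L\<^sup>2 * (norm (T ?x))\<^sup>2" by (intro mult_left_mono) auto
    ultimately show ?thesis by (simp add: x)
  qed
  have "(\<lambda>k. 2 * L^4 - 2 * L\<^sup>2 * (c (r k))\<^sup>2) \<longlonglongrightarrow> 2 * L^4 - 2 * L\<^sup>2 * L\<^sup>2"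
    by (intro tendsto_intros cr)
  then have "(\<lambda>k. 2 * L^4 - 2 * L\<^sup>2 * (c (r k))\<^sup>2) \<longlonglongrightarrow> 0" by (simp add: power4_eq_xxxx power2_eq_square)
  then have "(\<lambda>k. (norm (w k))\<^sup>2) \<longlonglongrightarrow> 0"
    by (rule tendsto_sandwich[OF _ _ tendsto_const, rotated 2]) (auto simp: w intro!: always_eventually)
  then have "(\<lambda>k. sqrt ((norm (w k))\<^sup>2)) \<longlonglongrightarrow> sqrt 0" by (rule tendsto_real_sqrt)
  then have w0: "w \<longlonglongrightarrow> 0" by (simp add: tendsto_norm_zero_iff)
  have "(\<lambda>k. (1 / L\<^sup>2) *\<^sub>R (T (T (x (r k))) - w k)) \<longlonglongrightarrow> (1 / L\<^sup>2) *\<^sub>R (T l - 0)"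
    by (intro tendsto_intros tendsto Txr w0)
  then have xl: "(\<lambda>k. x (r k)) \<longlonglongrightarrow> (1 / L\<^sup>2) *\<^sub>R T l" using L by (simp add: w_def)
  define y where "y = (1 / L\<^sup>2) *\<^sub>R T l"
  have "(\<lambda>k. norm (x (r k))) \<longlonglongrightarrow> norm y" unfolding y_def by (intro tendsto_norm xl)
  then have ny: "norm y = 1" by (simp add: x LIMSEQ_const_iff)
  have "l = T y" using LIMSEQ_unique[OF Txr tendsto[OF xl]] by (simp add: y_def)
  then have TTy: "T (T y) = L\<^sup>2 *\<^sub>R y" using L by (simp add: y_def)
  \<comment> \<open>\<open>(T + L) (T - L) y = 0\<close>, and \<open>T + L\<close> is injective since \<open>T \<ge> 0\<close> and \<open>L > 0\<close>.\<close>
  define z where "z = T y - L *\<^sub>R y"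
  have "T z = - L *\<^sub>R z" by (simp add: z_def diff scaleR TTy power2_eq_square algebra_simps)
  then have "0 \<le> - L * inner z z"
    using T(3) by (metis inner_scaleR_left nonneg_operator_def)
  then have "z = 0" using L by (smt (verit) inner_gt_zero_iff mult_neg_pos)
  then have "T y = L *\<^sub>R y" by (simp add: z_def)
  moreover have "y \<noteq> 0" using ny by auto
  ultimately show ?thesis by (auto simp: L_def)
qed

section \<open>Independence from joint characteristic functions\<close>

lemma integral_linear_combination3:
  fixes f1 f2 f3 :: "'a \<Rightarrow> complex"
  assumes "integrable M f1" "integrable M f2" "integrable M f3"
  shows "(CLINT x|M. a * f1 x + b * f2 x + c * f3 x) =
    a * (CLINT x|M. f1 x) + b * (CLINT x|M. f2 x) + c * (CLINT x|M. f3 x)"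
  using assms by simp

text \<open>
  Uniqueness of characteristic functions, for the law of \<open>X\<close> under the measure with density
  \<open>w / E w\<close>: its characteristic function is that of \<open>\<nu>\<close>.
\<close>

lemma weighted_law_from_char:
  fixes M :: "'a measure" and X w :: "'a \<Rightarrow> real"
  assumes M: "prob_space M" and X[measurable]: "X \<in> borel_measurable M"
    and w[measurable]: "w \<in> borel_measurable M" and w01: "\<And>x. 0 \<le> w x" "\<And>x. w x \<le> C"
    and \<nu>: "real_distribution \<nu>"
    and ch: "\<And>t. (CLINT x|M. w x * iexp (t * X x)) = (LINT x|M. w x) * char \<nu> t"
    and B[measurable]: "B \<in> sets borel"
  shows "(LINT x|M. w x * indicator B (X x)) = (LINT x|M. w x) * measure \<nu> B"
proof -
  interpret prob_space M by fact
  interpret \<nu>: real_distribution \<nu> by fact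
  define c where "c = (LINT x|M. w x)"
  have iw: "integrable M w"
    by (rule integrable_const_bound[of _ C]) (use w01 in auto)
  have c0: "0 \<le> c" unfolding c_def using w01(1) by (simp add: integral_nonneg_AE)
  show ?thesis
  proof (cases "c = 0")
    case True
    then have "AE x in M. w x = 0"
      using integral_nonneg_eq_0_iff_AE[OF iw] w01(1) by (simp add: c_def)
    then have "(LINT x|M. w x * indicator B (X x)) = (LINT x|M. 0)"
      by (intro integral_cong_AE) auto
    then show ?thesis using True by (simp add: c_def)
  next
    case False
    with c0 have c: "0 < c" by simp
    define N where "N = density M (\<lambda>x. w x / c)"
    define D where "D = distr N borel X"
    have [measurable]: "X \<in> borel_measurable N" by (simp add: N_def)
    have "emeasure N (space N) = 1"
    proof -
      have "emeasure N (space N) = (\<integral>\<^sup>+x. ennreal (w x / c) \<partial>M)"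
        by (simp add: N_def emeasure_density space_density cong: nn_integral_cong)
      also have "\<dots> = ennreal (LINT x|M. w x / c)"
        using iw w01(1) c by (intro nn_integral_eq_integral) auto
      also have "(LINT x|M. w x / c) = 1" using c by (simp add: c_def)
      finally show ?thesis by simp
    qed
    then interpret N: prob_space N by (rule prob_spaceI)
    have D: "real_distribution D" unfolding D_def by (rule N.real_distribution_distr) simp
    have "char D t = char \<nu> t" for t
    proof -
      have "char D t = (CLINT x|N. iexp (t * X x))"
        unfolding char_def D_def by (subst integral_distr) auto
      also have "\<dots> = (CLINT x|M. (w x / c) *\<^sub>R iexp (t * X x))"
        unfolding N_def using w01(1) c by (subst integral_density) auto
      also have "\<dots> = (CLINT x|M. (w x * iexp (t * X x)) / c)"
        by (simp add: scaleR_conv_of_real)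
      also have "\<dots> = (CLINT x|M. w x * iexp (t * X x)) / c" by (simp only: integral_divide_zero)
      also have "\<dots> = char \<nu> t" using c unfolding ch c_def[symmetric] by simp
      finally show ?thesis .
    qed
    then have "D = \<nu>" using D \<nu> by (intro Levy_uniqueness) auto
    then have "measure \<nu> B = measure D B" by simp
    also have "\<dots> = (LINT x|D. indicator B x)" by (simp add: D_def)
    also have "\<dots> = (LINT x|N. indicator B (X x))"
      unfolding D_def by (subst integral_distr) auto
    also have "\<dots> = (LINT x|M. (w x / c) *\<^sub>R indicator B (X x))"
      unfolding N_def using w01(1) c by (subst integral_density) auto
    also have "\<dots> = (LINT x|M. (w x * indicator B (X x)) / c)" by simp
    also have "\<dots> = (LINT x|M. w x * indicator B (X x)) / c" by (simp only: integral_divide_zero)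
    finally show ?thesis using c by (simp add: c_def[symmetric])
  qed
qed

text \<open>
  The preceding lemma needs a nonnegative weight; combining several such weights extends it to the complex
  weight \<open>g exp (i \<theta>)\<close>, where \<open>g\<close> will be a product of indicators of some coordinates and
  \<open>\<theta>\<close> a linear combination of others. The case \<open>s = -1\<close> of the hypothesis enters through
  \<open>cos \<theta>\<close> and \<open>sin \<theta>\<close>.
\<close>

lemma phase_law_from_char:
  fixes M :: "'a measure" and X g \<theta> :: "'a \<Rightarrow> real"
  assumes M: "prob_space M" and X[measurable]: "X \<in> borel_measurable M"
    and g[measurable]: "g \<in> borel_measurable M" and g01: "\<And>x. 0 \<le> g x" "\<And>x. g x \<le> 1"
    and \<theta>[measurable]: "\<theta> \<in> borel_measurable M"
    and \<nu>: "real_distribution \<nu>"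
    and ch: "\<And>s t. s \<in> {-1, 0, 1} \<Longrightarrow> (CLINT x|M. g x * iexp (s * \<theta> x + t * X x))
      = (CLINT x|M. g x * iexp (s * \<theta> x)) * char \<nu> t"
    and B[measurable]: "B \<in> sets borel"
  shows "(CLINT x|M. g x * indicator B (X x) * iexp (\<theta> x)) = (CLINT x|M. g x * iexp (\<theta> x)) * measure \<nu> B"
proof -
  interpret prob_space M by fact
  have gi: "integrable M (\<lambda>x. complex_of_real (g x) * u x)"
    if "u \<in> borel_measurable M" "\<And>x. norm (u x) \<le> 1" for u :: "'a \<Rightarrow> complex"
  proof (rule integrable_const_bound[of _ 1])
    show "AE x in M. norm (complex_of_real (g x) * u x) \<le> 1"
    proof (intro AE_I2)
      fix x
      have "norm (complex_of_real (g x) * u x) \<le> 1 * 1"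
        unfolding norm_mult using g01 that(2) by (intro mult_mono) auto
      then show "norm (complex_of_real (g x) * u x) \<le> 1" by simp
    qed
    show "(\<lambda>x. complex_of_real (g x) * u x) \<in> borel_measurable M" using that(1) by measurable
  qed
  have E1: "(CLINT x|M. g x * iexp (t * X x)) = (CLINT x|M. g x) * char \<nu> t" for t
    using ch[of 0 t] by simp
  have Ep: "(CLINT x|M. g x * (iexp (\<theta> x) * iexp (t * X x))) = (CLINT x|M. g x * iexp (\<theta> x)) * char \<nu> t" for t
    using ch[of 1 t] by (simp add: exp_add distrib_left)
  have Em: "(CLINT x|M. g x * (iexp (- \<theta> x) * iexp (t * X x))) = (CLINT x|M. g x * iexp (- \<theta> x)) * char \<nu> t" for t
    using ch[of "-1" t] by (simp add: exp_add[symmetric] algebra_simps)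
  have ie: "(\<lambda>x. iexp (\<theta> x)) \<in> borel_measurable M" "(\<lambda>x. iexp (- \<theta> x)) \<in> borel_measurable M"
    by measurable
  \<comment> \<open>The weights \<open>g\<close>, \<open>g (1 + cos \<theta>)\<close> and \<open>g (1 + sin \<theta>)\<close> are nonnegative and have the
    functions \<open>g\<close> and \<open>g exp (i\<theta>)\<close> in their complex span.\<close>
  have lin: "(CLINT x|M. g x * ((a + b * iexp (\<theta> x) + c * iexp (- \<theta> x)) * iexp (t * X x)))
      = (CLINT x|M. g x * (a + b * iexp (\<theta> x) + c * iexp (- \<theta> x))) * char \<nu> t" for a b c :: complex and t
  proof -
    have "(CLINT x|M. g x * ((a + b * iexp (\<theta> x) + c * iexp (- \<theta> x)) * iexp (t * X x)))
      = (CLINT x|M. a * (g x * iexp (t * X x)) + b * (g x * (iexp (\<theta> x) * iexp (t * X x)))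
          + c * (g x * (iexp (- \<theta> x) * iexp (t * X x))))"
      by (intro Bochner_Integration.integral_cong refl) (simp only: distrib_left distrib_right mult.assoc mult.left_commute)
    also have "\<dots> = a * (CLINT x|M. g x * iexp (t * X x)) + b * (CLINT x|M. g x * (iexp (\<theta> x) * iexp (t * X x)))
          + c * (CLINT x|M. g x * (iexp (- \<theta> x) * iexp (t * X x)))"
      by (intro integral_linear_combination3 gi) (measurable, simp_all add: norm_mult)
    also have "\<dots> = (a * (CLINT x|M. complex_of_real (g x) * 1) + b * (CLINT x|M. g x * iexp (\<theta> x)) + c * (CLINT x|M. g x * iexp (- \<theta> x))) * char \<nu> t"
      unfolding E1 Ep Em by (simp only: distrib_right mult.assoc mult_1_right)
    also have "a * (CLINT x|M. complex_of_real (g x) * 1) + b * (CLINT x|M. g x * iexp (\<theta> x)) + c * (CLINT x|M. g x * iexp (- \<theta> x))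
      = (CLINT x|M. a * (complex_of_real (g x) * 1) + b * (g x * iexp (\<theta> x)) + c * (g x * iexp (- \<theta> x)))"
      by (intro integral_linear_combination3[symmetric] gi) (simp_all add: ie)
    also have "\<dots> = (CLINT x|M. g x * (a + b * iexp (\<theta> x) + c * iexp (- \<theta> x)))"
      by (intro Bochner_Integration.integral_cong refl) (simp add: distrib_left mult.left_commute)
    finally show ?thesis .
  qed
  have cosE: "complex_of_real (1 + cos (\<theta> x)) = 1 + (1/2) * iexp (\<theta> x) + (1/2) * iexp (- \<theta> x)" for x
    using cos_exp_eq[of "complex_of_real (\<theta> x)"] by (simp add: cos_of_real add_divide_distrib)
  have sinE: "complex_of_real (1 + sin (\<theta> x)) = 1 + (1/(2*\<i>)) * iexp (\<theta> x) + (- 1/(2*\<i>)) * iexp (- \<theta> x)" for x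
    using sin_exp_eq[of "complex_of_real (\<theta> x)"] by (simp add: sin_of_real algebra_simps diff_divide_distrib)
  have W1: "(LINT x|M. g x * indicator B (X x)) = (LINT x|M. g x) * measure \<nu> B"
    by (rule weighted_law_from_char[OF M X g g01 \<nu> _ B]) (use E1 in simp)
  have W2: "(LINT x|M. g x * (1 + cos (\<theta> x)) * indicator B (X x)) = (LINT x|M. g x * (1 + cos (\<theta> x))) * measure \<nu> B"
  proof (rule weighted_law_from_char[OF M X _ _ _ \<nu> _ B, where C = 2])
    fix x
    have c: "0 \<le> 1 + cos (\<theta> x)" "1 + cos (\<theta> x) \<le> 2" using cos_ge_minus_one[of "\<theta> x"] cos_le_one[of "\<theta> x"] by linarith+
    then show "0 \<le> g x * (1 + cos (\<theta> x))" using g01(1) by simp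
    show "g x * (1 + cos (\<theta> x)) \<le> 2" using mult_mono[OF g01(2) c(2) _ c(1)] by simp
  next
    fix t
    show "(CLINT x|M. (g x * (1 + cos (\<theta> x))) * iexp (t * X x)) = (LINT x|M. g x * (1 + cos (\<theta> x))) * char \<nu> t"
      using lin[of 1 "1/2" "1/2" t] unfolding cosE[symmetric] of_real_mult[symmetric] integral_complex_of_real
      by (simp add: mult.assoc)
  qed simp
  have W3: "(LINT x|M. g x * (1 + sin (\<theta> x)) * indicator B (X x)) = (LINT x|M. g x * (1 + sin (\<theta> x))) * measure \<nu> B"
  proof (rule weighted_law_from_char[OF M X _ _ _ \<nu> _ B, where C = 2])
    fix x
    have c: "0 \<le> 1 + sin (\<theta> x)" "1 + sin (\<theta> x) \<le> 2" using sin_ge_minus_one[of "\<theta> x"] sin_le_one[of "\<theta> x"] by linarith+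
    then show "0 \<le> g x * (1 + sin (\<theta> x))" using g01(1) by simp
    show "g x * (1 + sin (\<theta> x)) \<le> 2" using mult_mono[OF g01(2) c(2) _ c(1)] by simp
  next
    fix t
    show "(CLINT x|M. (g x * (1 + sin (\<theta> x))) * iexp (t * X x)) = (LINT x|M. g x * (1 + sin (\<theta> x))) * char \<nu> t"
      using lin[of 1 "1/(2*\<i>)" "-1/(2*\<i>)" t] unfolding sinE[symmetric] of_real_mult[symmetric] integral_complex_of_real
      by (simp add: mult.assoc)
  qed simp
  have ri: "integrable M (\<lambda>x. g x * u x)" if "u \<in> borel_measurable M" "\<And>x. \<bar>u x\<bar> \<le> 1" for u :: "'a \<Rightarrow> real"
  proof (rule integrable_const_bound[of _ 1])
    show "AE x in M. norm (g x * u x) \<le> 1"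
    proof (intro AE_I2)
      fix x
      have "norm (g x * u x) \<le> 1 * 1"
        unfolding norm_mult using g01 that(2) by (intro mult_mono) auto
      then show "norm (g x * u x) \<le> 1" by simp
    qed
    show "(\<lambda>x. g x * u x) \<in> borel_measurable M" using that(1) by measurable
  qed
  have sub: "(LINT x|M. g x * (1 + u x) * v x) = (LINT x|M. g x * v x) + (LINT x|M. g x * (u x * v x))"
    if "u \<in> borel_measurable M" "\<And>x. \<bar>u x\<bar> \<le> 1" "v \<in> borel_measurable M" "\<And>x. \<bar>v x\<bar> \<le> 1" for u v :: "'a \<Rightarrow> real"
  proof -
    have "(LINT x|M. g x * (1 + u x) * v x) = (LINT x|M. g x * v x + g x * (u x * v x))"
      by (intro Bochner_Integration.integral_cong) (auto simp: algebra_simps)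
    also have "\<dots> = (LINT x|M. g x * v x) + (LINT x|M. g x * (u x * v x))"
      using that by (intro Bochner_Integration.integral_add ri) (auto simp: abs_mult intro: mult_le_one)
    finally show ?thesis .
  qed
  have CS: "(LINT x|M. g x * (u x * indicator B (X x))) = (LINT x|M. g x * u x) * measure \<nu> B"
    if u: "u \<in> borel_measurable M" "\<And>x. \<bar>u x\<bar> \<le> 1"
      and W: "(LINT x|M. g x * (1 + u x) * indicator B (X x)) = (LINT x|M. g x * (1 + u x)) * measure \<nu> B"
    for u :: "'a \<Rightarrow> real"
  proof -
    have a: "(LINT x|M. g x * (1 + u x) * indicator B (X x)) =
        (LINT x|M. g x * indicator B (X x)) + (LINT x|M. g x * (u x * indicator B (X x)))"
      by (rule sub[OF u]) (simp_all add: indicator_def)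
    have b: "(LINT x|M. g x * (1 + u x)) = (LINT x|M. g x) + (LINT x|M. g x * u x)"
      using sub[OF u, of "\<lambda>_. 1"] by simp
    show ?thesis using W unfolding a b W1 by (simp only: distrib_right add_left_cancel)
  qed
  have C: "(LINT x|M. g x * (cos (\<theta> x) * indicator B (X x))) = (LINT x|M. g x * cos (\<theta> x)) * measure \<nu> B"
    by (rule CS[OF _ _ W2]) simp_all
  have S: "(LINT x|M. g x * (sin (\<theta> x) * indicator B (X x))) = (LINT x|M. g x * sin (\<theta> x)) * measure \<nu> B"
    by (rule CS[OF _ _ W3]) simp_all
  have split: "(CLINT x|M. g x * v x * iexp (\<theta> x)) =
     complex_of_real (LINT x|M. g x * (cos (\<theta> x) * v x)) + \<i> * complex_of_real (LINT x|M. g x * (sin (\<theta> x) * v x))"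
    if "v \<in> borel_measurable M" "\<And>x. \<bar>v x\<bar> \<le> 1" for v :: "'a \<Rightarrow> real"
  proof -
    have "(CLINT x|M. g x * v x * iexp (\<theta> x)) =
       (CLINT x|M. complex_of_real (g x * (cos (\<theta> x) * v x)) + \<i> * complex_of_real (g x * (sin (\<theta> x) * v x)))"
      by (intro Bochner_Integration.integral_cong)
        (auto simp: exp_Euler algebra_simps cos_of_real sin_of_real)
    also have "\<dots> = (CLINT x|M. complex_of_real (g x * (cos (\<theta> x) * v x))) + (CLINT x|M. \<i> * complex_of_real (g x * (sin (\<theta> x) * v x)))"
      using that by (intro Bochner_Integration.integral_add integrable_mult_right integrable_of_real ri)
        (auto simp: abs_mult intro: mult_le_one)
    finally show ?thesis by (simp only: integral_mult_right_zero integral_complex_of_real)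
  qed
  show ?thesis
  proof -
    have "(CLINT x|M. g x * indicator B (X x) * iexp (\<theta> x)) =
        complex_of_real (LINT x|M. g x * (cos (\<theta> x) * indicator B (X x)))
        + \<i> * complex_of_real (LINT x|M. g x * (sin (\<theta> x) * indicator B (X x)))"
      by (rule split) (simp_all add: indicator_def)
    moreover have "(CLINT x|M. g x * iexp (\<theta> x)) =
        complex_of_real (LINT x|M. g x * cos (\<theta> x)) + \<i> * complex_of_real (LINT x|M. g x * sin (\<theta> x))"
      using split[of "\<lambda>_. 1"] by simp
    ultimately show ?thesis unfolding C S by (simp add: distrib_right mult.assoc)
  qed
qed

text \<open>
  Induction on \<open>j\<close> replaces one exponential factor after the other by an indicator. The weight in
  step \<open>j\<close> consists of the indicators already obtained and the exponentials still to be treated, so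
  uniqueness of one-dimensional characteristic functions suffices for a multivariate conclusion.
\<close>

lemma joint_law_from_char:
  fixes M :: "'a measure" and Z :: "nat \<Rightarrow> 'a \<Rightarrow> real"
  assumes M: "prob_space M" and Z: "\<And>i. i < k \<Longrightarrow> Z i \<in> borel_measurable M"
    and \<nu>: "real_distribution \<nu>"
    and ch: "\<And>a. (CLINT x|M. iexp (\<Sum>i<k. a i * Z i x)) = (\<Prod>i<k. char \<nu> (a i))"
    and "j \<le> k" and B: "\<And>i. i < j \<Longrightarrow> B i \<in> sets borel"
  shows "(CLINT x|M. (\<Prod>i<j. indicator (B i) (Z i x) :: real) * iexp (\<Sum>i=j..<k. a i * Z i x))
    = (\<Prod>i<j. measure \<nu> (B i)) * (\<Prod>i=j..<k. char \<nu> (a i))"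
  using assms(5,6)
proof (induction j arbitrary: a)
  case 0
  then show ?case using ch[of a] by (simp add: atLeast0LessThan)
next
  case (Suc j)
  interpret \<nu>: real_distribution \<nu> by fact
  define g where "g x = (\<Prod>i<j. indicator (B i) (Z i x) :: real)" for x
  define \<theta> where "\<theta> x = (\<Sum>i=Suc j..<k. a i * Z i x)" for x
  have jk: "j < k" using Suc.prems by simp
  have Zm[measurable]: "Z j \<in> borel_measurable M" using Z jk by blast
  have gm[measurable]: "g \<in> borel_measurable M"
    unfolding g_def using Z Suc.prems
    by (intro borel_measurable_prod) (auto intro!: measurable_compose[of "Z _" M borel] borel_measurable_indicator)
  have g01: "0 \<le> g x" "g x \<le> 1" for x
    unfolding g_def by (auto intro!: prod_nonneg prod_le_1 indicator_le_1)
  have \<theta>m[measurable]: "\<theta> \<in> borel_measurable M"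
    unfolding \<theta>_def using Z by (intro borel_measurable_sum borel_measurable_times) auto
  define p where "p = complex_of_real (\<Prod>i<j. measure \<nu> (B i))"
  have F: "(CLINT x|M. g x * iexp (s * \<theta> x + t * Z j x)) = p * (\<Prod>i=Suc j..<k. char \<nu> (s * a i)) * char \<nu> t" for s t
  proof -
    let ?a = "\<lambda>i. if i = j then t else s * a i"
    have split: "{j..<k} = insert j {Suc j..<k}" using jk by auto
    have sum: "(\<Sum>i=j..<k. ?a i * Z i x) = s * \<theta> x + t * Z j x" for x
    proof -
      have "(\<Sum>i=Suc j..<k. ?a i * Z i x) = (\<Sum>i=Suc j..<k. s * (a i * Z i x))"
        by (intro sum.cong) auto
      then show ?thesis unfolding split \<theta>_def by (simp add: sum_distrib_left)
    qed
    have "(\<Prod>i=Suc j..<k. char \<nu> (?a i)) = (\<Prod>i=Suc j..<k. char \<nu> (s * a i))"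
      by (intro prod.cong) auto
    then have prod: "(\<Prod>i=j..<k. char \<nu> (?a i)) = (\<Prod>i=Suc j..<k. char \<nu> (s * a i)) * char \<nu> t"
      unfolding split by (simp add: mult.commute)
    show ?thesis
      using Suc.IH[of ?a] Suc.prems unfolding sum prod g_def[symmetric] p_def[symmetric]
      by (simp add: mult.assoc)
  qed
  have "(CLINT x|M. g x * indicator (B j) (Z j x) * iexp (\<theta> x)) = (CLINT x|M. g x * iexp (\<theta> x)) * measure \<nu> (B j)"
  proof (rule phase_law_from_char[OF M Zm gm g01 \<theta>m \<nu>])
    fix s t :: real
    show "(CLINT x|M. g x * iexp (s * \<theta> x + t * Z j x)) = (CLINT x|M. g x * iexp (s * \<theta> x)) * char \<nu> t"
      using F[of s t] F[of s 0] by (simp add: \<nu>.char_zero)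
  qed (use Suc.prems in simp)
  then show ?case
    using F[of 1 0] unfolding g_def \<theta>_def by (simp add: \<nu>.char_zero p_def mult_ac)
qed

text \<open>
  For \<open>j = k\<close> the preceding lemma gives the probabilities of all rectangles, which determine the joint
  law.
\<close>

lemma indep_vars_from_char:
  fixes M :: "'a measure" and Z :: "nat \<Rightarrow> 'a \<Rightarrow> real"
  assumes M: "prob_space M" and Z: "\<And>i. i < k \<Longrightarrow> Z i \<in> borel_measurable M"
    and \<nu>: "real_distribution \<nu>"
    and ch: "\<And>a. (CLINT x|M. iexp (\<Sum>i<k. a i * Z i x)) = (\<Prod>i<k. char \<nu> (a i))"
  shows "\<And>i. i < k \<Longrightarrow> distr M borel (Z i) = \<nu>"
    and "prob_space.indep_vars M (\<lambda>_. borel) Z {..<k}"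
proof -
  interpret prob_space M by fact
  interpret \<nu>: real_distribution \<nu> by fact
  have psf: "product_sigma_finite (\<lambda>_::nat. \<nu>)"
    by (simp add: product_sigma_finite_def \<nu>.sigma_finite_measure_axioms)
  have rect: "measure M {x \<in> space M. \<forall>i<k. Z i x \<in> B i} = (\<Prod>i<k. measure \<nu> (B i))"
    if B: "\<And>i. i < k \<Longrightarrow> B i \<in> sets borel" for B
  proof -
    let ?E = "{x \<in> space M. \<forall>i<k. Z i x \<in> B i}"
    have E: "?E \<in> sets M"
    proof -
      have "?E = {x \<in> space M. \<forall>i\<in>{..<k}. Z i x \<in> B i}" by auto
      also have "\<dots> \<in> sets M"
      proof (intro sets.sets_Collect_finite_All finite_lessThan)
        fix i assume "i \<in> {..<k}"
        then have "Z i -` B i \<inter> space M \<in> sets M" using Z B by (intro measurable_sets) auto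
        moreover have "{x \<in> space M. Z i x \<in> B i} = Z i -` B i \<inter> space M" by auto
        ultimately show "{x \<in> space M. Z i x \<in> B i} \<in> sets M" by simp
      qed
      finally show ?thesis .
    qed
    have ind: "(\<Prod>i<k. indicator (B i) (Z i x) :: real) = indicator ?E x" if "x \<in> space M" for x
      using that by (auto simp: indicator_def prod_zero_iff)
    have "complex_of_real (measure M ?E) = (CLINT x|M. complex_of_real (indicator ?E x))"
    proof -
      have "?E \<inter> space M = ?E" by (intro Int_absorb2 Collect_subset)
      then show ?thesis using E by (simp only: integral_complex_of_real Bochner_Integration.integral_indicator)
    qed
    also have "\<dots> = (CLINT x|M. (\<Prod>i<k. indicator (B i) (Z i x) :: real) * iexp (\<Sum>i=k..<k. 0 * Z i x))"
      by (intro Bochner_Integration.integral_cong refl) (simp only: ind, simp)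
    also have "\<dots> = (\<Prod>i<k. measure \<nu> (B i)) * (\<Prod>i=k..<k. char \<nu> 0)"
      by (rule joint_law_from_char[OF M Z \<nu> ch order_refl B])
    also have "\<dots> = complex_of_real (\<Prod>i<k. measure \<nu> (B i))" by simp
    finally show ?thesis by (simp only: of_real_eq_iff)
  qed
  show D: "distr M borel (Z i) = \<nu>" if i: "i < k" for i
  proof (rule measure_eqI)
    fix A assume "A \<in> sets (distr M borel (Z i))"
    then have A: "A \<in> sets borel" by simp
    define B where "B l = (if l = i then A else UNIV)" for l
    have "{x \<in> space M. \<forall>l<k. Z l x \<in> B l} = Z i -` A \<inter> space M" using i by (auto simp: B_def)
    moreover have "(\<Prod>l<k. measure \<nu> (B l)) = (\<Prod>l<k. if l = i then measure \<nu> A else 1)"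
      using \<nu>.prob_space by (intro prod.cong) (auto simp: B_def)
    ultimately have "measure M (Z i -` A \<inter> space M) = measure \<nu> A"
      using rect[of B] A i by (simp add: B_def)
    then show "emeasure (distr M borel (Z i)) A = emeasure \<nu> A"
      using A Z[OF i] by (simp add: emeasure_distr emeasure_eq_measure \<nu>.emeasure_eq_measure)
  qed simp
  show "indep_vars (\<lambda>_. borel) Z {..<k}"
  proof (cases "k = 0")
    case True
    then show ?thesis by (simp add: indep_vars_def indep_sets_def)
  next
    case False
    have Zr: "(\<lambda>x. \<lambda>i\<in>{..<k}. Z i x) \<in> M \<rightarrow>\<^sub>M PiM {..<k} (\<lambda>_. borel)"
      using Z by (intro measurable_restrict) auto
    have sP: "sets (PiM {..<k} (\<lambda>_. \<nu>)) = sets (PiM {..<k} (\<lambda>_. borel))"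
      by (intro sets_PiM_cong) auto
    have "distr M (PiM {..<k} (\<lambda>_. borel)) (\<lambda>x. \<lambda>i\<in>{..<k}. Z i x) = PiM {..<k} (\<lambda>_. \<nu>)"
    proof (rule product_sigma_finite.PiM_eqI[OF psf])
      fix A assume A: "\<And>i. i \<in> {..<k} \<Longrightarrow> A i \<in> sets \<nu>"
      have "(\<lambda>x. \<lambda>i\<in>{..<k}. Z i x) -` Pi\<^sub>E {..<k} A \<inter> space M = {x \<in> space M. \<forall>i<k. Z i x \<in> A i}"
        unfolding set_eq_iff Int_iff by (auto simp: PiE_iff)
      moreover have "Pi\<^sub>E {..<k} A \<in> sets (PiM {..<k} (\<lambda>_. borel))"
        using A by (intro sets_PiM_I_finite) auto
      ultimately show "emeasure (distr M (PiM {..<k} (\<lambda>_. borel)) (\<lambda>x. \<lambda>i\<in>{..<k}. Z i x)) (Pi\<^sub>E {..<k} A)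
          = (\<Prod>i\<in>{..<k}. emeasure \<nu> (A i))"
        using rect[of A] A Zr
        by (simp add: emeasure_distr emeasure_eq_measure \<nu>.emeasure_eq_measure prod_ennreal)
    qed (simp_all add: sP)
    also have "\<dots> = PiM {..<k} (\<lambda>i. distr M borel (Z i))" by (intro PiM_cong) (auto simp: D)
    finally show ?thesis using False Z by (subst indep_vars_iff_distr_eq_PiM') auto
  qed
qed

section \<open>Quantiles and the Fisher distribution\<close>

text \<open>
  Right-continuity gives \<open>cdf D q \<ge> a\<close> at the quantile \<open>q\<close>, and without an atom at \<open>q\<close> the
  same bound holds for \<open>D {..<q}\<close>.
\<close>

lemma quantile_tail:
  assumes "real_distribution D" and atomless: "\<And>q. measure D {q} = 0" and a: "0 < a" "a < 1"
  shows "measure D {quantile D a..} \<le> 1 - a"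
proof -
  interpret real_distribution D by fact
  define S where "S = {x. a \<le> cdf D x}"
  define q where "q = quantile D a"
  have "\<forall>\<^sub>F x in at_top. a < cdf D x"
    by (rule order_tendstoD(1)[OF cdf_lim_at_top_prob a(2)])
  then obtain x where "a < cdf D x" by (metis eventually_at_top_linorder order_refl)
  then have "S \<noteq> {}" by (auto simp: S_def intro: less_imp_le)
  have "a \<le> cdf D x" if "q < x" for x
  proof -
    have "Inf S < x" using that by (simp add: q_def quantile_def S_def)
    then obtain s where "s \<in> S" "s < x" using \<open>S \<noteq> {}\<close> cInf_lessD by blast
    then show ?thesis using cdf_nondecreasing[of s x] by (simp add: S_def)
  qed
  then have "\<forall>\<^sub>F x in at_right q. a \<le> cdf D x" by (auto simp: eventually_at_filter)
  moreover have "(cdf D \<longlongrightarrow> cdf D q) (at_right q)"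
    using cdf_is_right_cont[of q] by (simp add: continuous_within)
  ultimately have "a \<le> cdf D q" by (intro tendsto_lowerbound[of "cdf D" _ "at_right q"]) auto
  also have "cdf D q = measure D {..<q} + measure D {q}"
  proof -
    have "{..q} = {..<q} \<union> {q}" by auto
    then show ?thesis unfolding cdf_def2 by (simp only:) (rule finite_measure_Union, auto)
  qed
  also have "measure D {..<q} = 1 - measure D {q..}"
  proof -
    have "space D - {q..} = {..<q}" by auto
    then show ?thesis using prob_compl[of "{q..}"] by simp
  qed
  finally show ?thesis using atomless[of q] by (simp add: q_def)
qed

context prob_space
begin

text \<open>
  By Fubini: given the value of \<open>Y\<close>, the equation \<open>h X Y = c\<close> confines \<open>X\<close> to finitely
  many points.
\<close>

lemma indep_atomless:
  fixes X Y :: "'a \<Rightarrow> real" and h :: "real \<Rightarrow> real \<Rightarrow> real"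
  assumes ind: "indep_var borel X borel Y"
    and h[measurable]: "(\<lambda>(x, y). h x y) \<in> borel_measurable (borel \<Otimes>\<^sub>M borel)"
    and X: "\<And>c. prob {\<omega> \<in> space M. X \<omega> = c} = 0"
    and fin: "AE \<omega> in M. finite {x. h x (Y \<omega>) = c}"
  shows "prob {\<omega> \<in> space M. h (X \<omega>) (Y \<omega>) = c} = 0"
proof -
  have [measurable]: "X \<in> borel_measurable M" "Y \<in> borel_measurable M"
    using ind indep_var_rv1 indep_var_rv2 by blast+
  let ?X = "distr M borel X" and ?Y = "distr M borel Y"
  interpret X: prob_space ?X by (rule prob_space_distr) simp
  interpret Y: prob_space ?Y by (rule prob_space_distr) simp
  interpret XY: pair_prob_space ?X ?Y ..
  have law: "?X \<Otimes>\<^sub>M ?Y = distr M (borel \<Otimes>\<^sub>M borel) (\<lambda>\<omega>. (X \<omega>, Y \<omega>))"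
    using ind by (simp add: indep_var_distribution_eq)
  define E where "E = {p \<in> space (borel \<Otimes>\<^sub>M borel). (case p of (x, y) \<Rightarrow> h x y) = c}"
  have E[measurable]: "E \<in> sets (borel \<Otimes>\<^sub>M borel)" unfolding E_def by measurable
  have null: "emeasure ?X S = 0" if "finite S" for S
  proof -
    have "emeasure ?X {s} = 0" for s
    proof -
      have "emeasure ?X {s} = emeasure M (X -` {s} \<inter> space M)" by (rule emeasure_distr) auto
      also have "X -` {s} \<inter> space M = {\<omega> \<in> space M. X \<omega> = s}" unfolding set_eq_iff Int_iff by auto
      finally show ?thesis using X[of s] by (simp add: emeasure_eq_measure)
    qed
    moreover have "emeasure ?X S = (\<Sum>s\<in>S. emeasure ?X {s})"
      using that by (intro emeasure_eq_sum_singleton) auto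
    ultimately show ?thesis by simp
  qed
  have "emeasure M {\<omega> \<in> space M. h (X \<omega>) (Y \<omega>) = c} = emeasure (?X \<Otimes>\<^sub>M ?Y) E"
  proof -
    have "(\<lambda>\<omega>. (X \<omega>, Y \<omega>)) -` E \<inter> space M = {\<omega> \<in> space M. h (X \<omega>) (Y \<omega>) = c}"
      unfolding set_eq_iff Int_iff E_def by (auto simp: space_pair_measure)
    then show ?thesis unfolding law by (subst emeasure_distr) auto
  qed
  also have "\<dots> = (\<integral>\<^sup>+y. emeasure ?X ((\<lambda>x. (x, y)) -` E) \<partial>?Y)"
    by (rule XY.emeasure_pair_measure_alt2) (simp add: E cong: sets_pair_measure_cong)
  also have "\<dots> = (\<integral>\<^sup>+\<omega>. emeasure ?X ((\<lambda>x. (x, Y \<omega>)) -` E) \<partial>M)"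
  proof (rule nn_integral_distr)
    have "E \<in> sets (?X \<Otimes>\<^sub>M ?Y)" by (simp add: E cong: sets_pair_measure_cong)
    then show "(\<lambda>y. emeasure ?X ((\<lambda>x. (x, y)) -` E)) \<in> borel_measurable ?Y"
      by (rule XY.measurable_emeasure_Pair2)
  qed simp
  also have "\<dots> = (\<integral>\<^sup>+\<omega>. 0 \<partial>M)"
  proof (rule nn_integral_cong_AE)
    show "AE \<omega> in M. emeasure ?X ((\<lambda>x. (x, Y \<omega>)) -` E) = 0"
      using fin
    proof (rule AE_mp, intro AE_I2 impI)
      fix \<omega> assume "finite {x. h x (Y \<omega>) = c}"
      moreover have "(\<lambda>x. (x, Y \<omega>)) -` E = {x. h x (Y \<omega>) = c}"
        by (auto simp: E_def space_pair_measure)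
      ultimately show "emeasure ?X ((\<lambda>x. (x, Y \<omega>)) -` E) = 0" using null by simp
    qed
  qed
  finally show ?thesis by (simp add: measure_def)
qed

lemma std_normal_atomless:
  assumes "Z \<in> borel_measurable M" "distr M borel Z = std_normal_distribution"
  shows "prob {\<omega> \<in> space M. Z \<omega> = c} = 0"
proof -
  have "emeasure (distr M borel Z) {c} = emeasure M (Z -` {c} \<inter> space M)"
    using assms(1) by (rule emeasure_distr) auto
  also have "Z -` {c} \<inter> space M = {\<omega> \<in> space M. Z \<omega> = c}" unfolding set_eq_iff Int_iff by auto
  finally have "emeasure M {\<omega> \<in> space M. Z \<omega> = c} = emeasure std_normal_distribution {c}" by (simp add: assms(2))
  also have "\<dots> = 0"
    by (subst emeasure_density) (auto simp: nn_integral_0_iff_AE intro!: AE_I'[of "{c}"])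
  finally show ?thesis by (simp add: measure_def)
qed

lemma sum_squares_atomless:
  fixes Z :: "'i \<Rightarrow> 'a \<Rightarrow> real"
  assumes I: "finite I" "I \<noteq> {}" and ind: "indep_vars (\<lambda>_. borel) Z I"
    and Z: "\<And>i. i \<in> I \<Longrightarrow> distr M borel (Z i) = std_normal_distribution"
  shows "prob {\<omega> \<in> space M. (\<Sum>i\<in>I. (Z i \<omega>)\<^sup>2) = c} = 0"
proof -
  obtain i J where J: "I = insert i J" "i \<notin> J" using I(2) by (meson Set.set_insert ex_in_conv)
  have rv: "Z i \<in> borel_measurable M" using ind J by (auto simp: indep_vars_def)
  have sq: "indep_vars (\<lambda>_. borel) (\<lambda>i \<omega>. (Z i \<omega>)\<^sup>2) (insert i J)"
    using indep_vars_compose2[OF ind, of "\<lambda>_ x. x\<^sup>2" "\<lambda>_. borel"] J by simp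
  have Ji: "indep_var borel (\<lambda>\<omega>. (Z i \<omega>)\<^sup>2) borel (\<lambda>\<omega>. \<Sum>i\<in>J. (Z i \<omega>)\<^sup>2)"
    using indep_vars_sum[OF _ J(2) sq] I(1) J(1) by simp
  have sq0: "prob {\<omega> \<in> space M. (Z i \<omega>)\<^sup>2 = d} = 0" for d
  proof -
    have "{\<omega> \<in> space M. (Z i \<omega>)\<^sup>2 = d} \<subseteq> {\<omega> \<in> space M. Z i \<omega> = sqrt d} \<union> {\<omega> \<in> space M. Z i \<omega> = - sqrt d}"
      by auto
    moreover have "{\<omega> \<in> space M. Z i \<omega> = a} \<in> null_sets M" for a
      using std_normal_atomless[OF rv Z, of a] J rv
      by (auto simp: null_sets_def emeasure_eq_measure)
    then have "{\<omega> \<in> space M. Z i \<omega> = sqrt d} \<union> {\<omega> \<in> space M. Z i \<omega> = - sqrt d} \<in> null_sets M"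
      by (intro null_sets.Un)
    moreover have "{\<omega> \<in> space M. (Z i \<omega>)\<^sup>2 = d} \<in> sets M" using rv by measurable
    ultimately have "{\<omega> \<in> space M. (Z i \<omega>)\<^sup>2 = d} \<in> null_sets M" by (meson null_sets_subset)
    then show ?thesis by (simp add: null_sets_def measure_def)
  qed
  have "prob {\<omega> \<in> space M. (Z i \<omega>)\<^sup>2 + (\<Sum>i\<in>J. (Z i \<omega>)\<^sup>2) = c} = 0"
  proof (rule indep_atomless[OF Ji, of "\<lambda>x y. x + y"])
    have "{x. x + y = c} = {c - y}" for y :: real by auto
    then show "AE \<omega> in M. finite {x. x + (\<Sum>i\<in>J. (Z i \<omega>)\<^sup>2) = c}" by simp
  qed (simp_all add: sq0)
  then show ?thesis using J I(1) by simp
qed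

text \<open>
  The index set is an arbitrary interval because the denominator of the Fisher ratio uses the coordinates
  from \<open>m\<close> on.
\<close>

lemma distr_sum_squares:
  fixes Z :: "nat \<Rightarrow> 'a \<Rightarrow> real"
  assumes k: "0 < k" and ind: "indep_vars (\<lambda>_. borel) Z {l..<l+k}"
    and Z: "\<And>i. i \<in> {l..<l+k} \<Longrightarrow> distr M borel (Z i) = std_normal_distribution"
  shows "distr M borel (\<lambda>\<omega>. \<Sum>i\<in>{l..<l+k}. (Z i \<omega>)\<^sup>2) = chi_square_distribution k"
proof -
  let ?N = "std_normal_distribution" and ?I = "{l..<l+k}"
  have rv: "i \<in> ?I \<Longrightarrow> Z i \<in> borel_measurable M" for i using ind by (auto simp: indep_vars_def)
  have psN: "prob_space ?N" using real_dist_normal_dist real_distribution_def by blast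
  have law: "distr M (PiM ?I (\<lambda>_. borel)) (\<lambda>\<omega>. \<lambda>i\<in>?I. Z i \<omega>) = PiM ?I (\<lambda>_. ?N)"
  proof -
    have "distr M (PiM ?I (\<lambda>_. borel)) (\<lambda>\<omega>. \<lambda>i\<in>?I. Z i \<omega>) = PiM ?I (\<lambda>i. distr M borel (Z i))"
      using ind k rv by (subst (asm) indep_vars_iff_distr_eq_PiM') auto
    also have "\<dots> = PiM ?I (\<lambda>_. ?N)" by (intro PiM_cong) (auto simp: Z)
    finally show ?thesis .
  qed
  have shift: "distr (PiM ?I (\<lambda>_. ?N)) (PiM {..<k} (\<lambda>_. ?N)) (\<lambda>\<omega>. \<lambda>n\<in>{..<k}. \<omega> (l + n)) = PiM {..<k} (\<lambda>_. ?N)"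
    by (rule distr_PiM_reindex) (use psN in auto)
  have sP: "sets (PiM J (\<lambda>_. ?N)) = sets (PiM J (\<lambda>_. borel))" for J :: "nat set"
    by (intro sets_PiM_cong) auto
  have "chi_square_distribution k = distr (distr (PiM ?I (\<lambda>_. ?N)) (PiM {..<k} (\<lambda>_. ?N)) (\<lambda>\<omega>. \<lambda>n\<in>{..<k}. \<omega> (l + n)))
      borel (\<lambda>x. \<Sum>i<k. (x i)\<^sup>2)"
    unfolding shift chi_square_distribution_def ..
  also have "\<dots> = distr (PiM ?I (\<lambda>_. ?N)) borel (\<lambda>\<omega>. \<Sum>i<k. (\<omega> (l + i))\<^sup>2)"
    by (subst distr_distr) (auto simp: o_def intro!: measurable_restrict distr_cong)
  also have "\<dots> = distr M borel (\<lambda>\<omega>. \<Sum>i<k. (Z (l + i) \<omega>)\<^sup>2)"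
    unfolding law[symmetric] using rv
    by (subst distr_distr) (auto simp: o_def intro!: measurable_restrict distr_cong)
  also have "(\<lambda>\<omega>. \<Sum>i<k. (Z (l + i) \<omega>)\<^sup>2) = (\<lambda>\<omega>. \<Sum>i\<in>?I. (Z i \<omega>)\<^sup>2)"
    by (intro ext sum.reindex_bij_witness[of _ "\<lambda>i. i - l" "\<lambda>i. l + i"]) auto
  finally show ?thesis ..
qed

text \<open>
  Off the null event where the denominator vanishes, the value of the ratio and that of the denominator
  determine the numerator; so the ratio has no atoms because the numerator has none.
\<close>

lemma fisher_ratio:
  fixes Z :: "nat \<Rightarrow> 'a \<Rightarrow> real"
  assumes mn: "0 < m" "0 < n" and ind: "indep_vars (\<lambda>_. borel) Z {..<m+n}"
    and Z: "\<And>i. i < m + n \<Longrightarrow> distr M borel (Z i) = std_normal_distribution"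
  defines "F \<equiv> \<lambda>\<omega>. ((\<Sum>i\<in>{0..<m}. (Z i \<omega>)\<^sup>2) / real m) / ((\<Sum>i\<in>{m..<m+n}. (Z i \<omega>)\<^sup>2) / real n)"
  shows "F \<in> borel_measurable M" "distr M borel F = fisher_distribution m n"
    and "prob {\<omega> \<in> space M. F \<omega> = c} = 0"
proof -
  let ?X = "\<lambda>\<omega>. \<Sum>i\<in>{0..<m}. (Z i \<omega>)\<^sup>2" and ?Y = "\<lambda>\<omega>. \<Sum>i\<in>{m..<m+n}. (Z i \<omega>)\<^sup>2"
  have ind1: "indep_vars (\<lambda>_. borel) Z {0..<0+m}" by (rule indep_vars_subset[OF ind]) auto
  have ind2: "indep_vars (\<lambda>_. borel) Z {m..<m+n}" by (rule indep_vars_subset[OF ind]) auto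
  have chi1: "distr M borel ?X = chi_square_distribution m"
    using distr_sum_squares[OF mn(1) ind1] Z by simp
  have chi2: "distr M borel ?Y = chi_square_distribution n"
    using distr_sum_squares[OF mn(2) ind2] Z by simp
  have XY: "indep_var borel ?X borel ?Y"
  proof -
    have "indep_var
      borel ((\<lambda>f. \<Sum>i\<in>{0..<m}. (f i)\<^sup>2) \<circ> (\<lambda>\<omega>. restrict (\<lambda>i. Z i \<omega>) {0..<m}))
      borel ((\<lambda>f. \<Sum>i\<in>{m..<m+n}. (f i)\<^sup>2) \<circ> (\<lambda>\<omega>. restrict (\<lambda>i. Z i \<omega>) {m..<m+n}))"
      by (intro indep_var_compose[OF indep_var_restrict[OF ind]]) auto
    also have "(\<lambda>f. \<Sum>i\<in>{0..<m}. (f i)\<^sup>2) \<circ> (\<lambda>\<omega>. restrict (\<lambda>i. Z i \<omega>) {0..<m}) = ?X" by auto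
    also have "(\<lambda>f. \<Sum>i\<in>{m..<m+n}. (f i)\<^sup>2) \<circ> (\<lambda>\<omega>. restrict (\<lambda>i. Z i \<omega>) {m..<m+n}) = ?Y" by auto
    finally show ?thesis .
  qed
  have [measurable]: "?X \<in> borel_measurable M" "?Y \<in> borel_measurable M"
    using XY indep_var_rv1 indep_var_rv2 by blast+
  show "F \<in> borel_measurable M" unfolding F_def by measurable
  have "fisher_distribution m n = distr (distr M (borel \<Otimes>\<^sub>M borel) (\<lambda>\<omega>. (?X \<omega>, ?Y \<omega>))) borel
      (\<lambda>(x, y). (x / real m) / (y / real n))"
    using XY unfolding fisher_distribution_def chi1[symmetric] chi2[symmetric]
    by (simp add: indep_var_distribution_eq)
  also have "\<dots> = distr M borel F" unfolding F_def by (subst distr_distr) (auto simp: o_def)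
  finally show "distr M borel F = fisher_distribution m n" ..
  have Y0: "prob {\<omega> \<in> space M. ?Y \<omega> = 0} = 0"
    by (rule sum_squares_atomless[OF _ _ ind2]) (use mn Z in auto)
  have AEY: "AE \<omega> in M. ?Y \<omega> \<noteq> 0"
  proof (rule AE_I[of _ _ "{\<omega> \<in> space M. ?Y \<omega> = 0}"])
    show "emeasure M {\<omega> \<in> space M. ?Y \<omega> = 0} = 0" using Y0 by (simp add: emeasure_eq_measure)
    show "{\<omega> \<in> space M. ?Y \<omega> = 0} \<in> sets M" by measurable
  qed auto
  show "prob {\<omega> \<in> space M. F \<omega> = c} = 0"
    unfolding F_def
  proof (intro indep_atomless[OF XY, of "\<lambda>x y. (x / real m) / (y / real n)"], goal_cases)
    case 1 then show ?case by measurable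
  next
    case (2 d)
    then show ?case by (rule sum_squares_atomless[OF _ _ ind1[simplified]]) (use mn Z in auto)
  next
    case 3
    show ?case
      using AEY
    proof (rule AE_mp, intro AE_I2 impI)
      fix \<omega> assume "?Y \<omega> \<noteq> 0"
      then have "{x. (x / real m) / (?Y \<omega> / real n) = c} \<subseteq> {c * (?Y \<omega> / real n) * real m}"
        using mn by (auto simp: field_simps)
      then show "finite {x. (x / real m) / (?Y \<omega> / real n) = c}" using finite_subset by blast
    qed
  qed
qed

text \<open>
  The comparison of \<open>T\<close> with the Fisher ratio is asked for only where the denominator is nonzero,
  which is almost everywhere.
\<close>

lemma fisher_tail:
  fixes Z :: "nat \<Rightarrow> 'a \<Rightarrow> real" and T :: "'a \<Rightarrow> real"
  assumes mn: "0 < m" "0 < n" and ind: "indep_vars (\<lambda>_. borel) Z {..<m+n}"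
    and Z: "\<And>i. i < m + n \<Longrightarrow> distr M borel (Z i) = std_normal_distribution"
    and T[measurable]: "T \<in> borel_measurable M"
    and le: "AE \<omega> in M. (\<Sum>i\<in>{m..<m+n}. (Z i \<omega>)\<^sup>2) \<noteq> 0 \<longrightarrow>
      T \<omega> \<le> ((\<Sum>i\<in>{0..<m}. (Z i \<omega>)\<^sup>2) / real m) / ((\<Sum>i\<in>{m..<m+n}. (Z i \<omega>)\<^sup>2) / real n)"
    and \<alpha>: "0 < \<alpha>" "\<alpha> < 1"
  shows "prob {\<omega> \<in> space M. quantile (fisher_distribution m n) (1 - \<alpha>) \<le> T \<omega>} \<le> \<alpha>"
proof -
  let ?Y = "\<lambda>\<omega>. \<Sum>i\<in>{m..<m+n}. (Z i \<omega>)\<^sup>2"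
  define F where "F \<omega> = ((\<Sum>i\<in>{0..<m}. (Z i \<omega>)\<^sup>2) / real m) / (?Y \<omega> / real n)" for \<omega>
  note F = fisher_ratio[OF mn ind Z, folded F_def]
  note [measurable] = F(1)
  let ?q = "quantile (fisher_distribution m n) (1 - \<alpha>)"
  have pre: "measure (distr M borel F) A = prob {\<omega> \<in> space M. F \<omega> \<in> A}" if "A \<in> sets borel" for A
  proof -
    have "F -` A \<inter> space M = {\<omega> \<in> space M. F \<omega> \<in> A}" unfolding set_eq_iff Int_iff by auto
    then show ?thesis using measure_distr[OF F(1) that] by simp
  qed
  have "measure (distr M borel F) {quantile (distr M borel F) (1 - \<alpha>)..} \<le> 1 - (1 - \<alpha>)"
    by (rule quantile_tail) (use \<alpha> F(3) pre in auto)
  then have tail: "prob {\<omega> \<in> space M. ?q \<le> F \<omega>} \<le> \<alpha>" by (simp add: F(2)[symmetric] pre)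
  have ind2: "indep_vars (\<lambda>_. borel) Z {m..<m+n}" by (rule indep_vars_subset[OF ind]) auto
  have Y0: "prob {\<omega> \<in> space M. ?Y \<omega> = 0} = 0"
    by (rule sum_squares_atomless[OF _ _ ind2]) (use mn Z in auto)
  have [measurable]: "?Y \<in> borel_measurable M"
    using ind2 by (intro borel_measurable_sum borel_measurable_power) (auto simp: indep_vars_def)
  have "AE \<omega> in M. ?Y \<omega> \<noteq> 0"
  proof (rule AE_I[of _ _ "{\<omega> \<in> space M. ?Y \<omega> = 0}"])
    show "emeasure M {\<omega> \<in> space M. ?Y \<omega> = 0} = 0" using Y0 by (simp add: emeasure_eq_measure)
    show "{\<omega> \<in> space M. ?Y \<omega> = 0} \<in> sets M" by measurable
  qed auto
  with le have "AE \<omega> in M. T \<omega> \<le> F \<omega>" unfolding F_def by eventually_elim simp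
  then have "AE \<omega> in M. \<omega> \<in> {\<omega> \<in> space M. ?q \<le> T \<omega>} \<longrightarrow> \<omega> \<in> {\<omega> \<in> space M. ?q \<le> F \<omega>}"
    by eventually_elim auto
  then have "prob {\<omega> \<in> space M. ?q \<le> T \<omega>} \<le> prob {\<omega> \<in> space M. ?q \<le> F \<omega>}"
    by (intro finite_measure_mono_AE) auto
  with tail show ?thesis by simp
qed

end

section \<open>Gaussian measures and the level of the test\<close>

lemma char_normal_law:
  assumes v: "0 \<le> v"
  shows "char (normal_law 0 v) 1 = exp (- v / 2)"
proof (cases "v = 0")
  case True
  then show ?thesis by (simp add: normal_law_def char_def integral_return)
next
  case False
  let ?N = std_normal_distribution
  define s where "s = sqrt v"
  have s: "0 < s" using v False by (simp add: s_def)
  interpret N: real_distribution ?N by (rule real_dist_normal_dist)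
  have "distributed ?N lborel (\<lambda>x. x) std_normal_density"
    by (simp add: distributed_def distr_id2)
  from N.normal_density_affine[OF this, of s 0] s
  have "distributed ?N lborel (\<lambda>x. s * x) (normal_density 0 s)" by simp
  then have "normal_law 0 v = distr ?N lborel (\<lambda>x. s * x)"
    using False by (simp add: normal_law_def distributed_def s_def)
  then have "char (normal_law 0 v) 1 = (CLINT x|?N. iexp (s * x))"
    unfolding char_def by (subst integral_distr[symmetric, where N = lborel]) auto
  also have "\<dots> = char ?N s" by (simp add: char_def)
  also have "\<dots> = exp (- v / 2)" using v by (simp add: char_std_normal_distribution s_def)
  finally show ?thesis .
qed

lemma gaussian_char:
  fixes M :: "'h::{real_inner,second_countable_topology} measure"
  assumes M: "is_gaussian M \<xi> C" and b: "inner b \<xi> = 0" "0 \<le> inner (C b) b"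
  shows "(CLINT y|M. iexp (inner b y)) = exp (- inner (C b) b / 2)"
proof -
  have sM[measurable_cong]: "sets M = sets borel" using M by (simp add: is_gaussian_def)
  have "(CLINT y|M. iexp (inner b y)) = (CLINT x|distr M borel (\<lambda>y. inner b y). iexp x)"
    by (subst integral_distr) auto
  also have "distr M borel (\<lambda>y. inner b y) = normal_law 0 (inner (C b) b)"
    using M b by (simp add: is_gaussian_def)
  also have "(CLINT x|normal_law 0 (inner (C b) b). iexp x) = char (normal_law 0 (inner (C b) b)) 1"
    by (simp add: char_def)
  finally show ?thesis by (simp only: char_normal_law[OF b(2)])
qed

text \<open>
  Orthonormality for the covariance form makes \<open>\<Sum> a_i c_i\<close> have variance \<open>\<Sum> a_i\<^sup>2\<close>,
  so the joint characteristic function is that of independent standard normal variables.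
\<close>

lemma gaussian_white_coordinates:
  fixes M :: "'h::{real_inner,second_countable_topology} measure" and c :: "nat \<Rightarrow> 'h"
  assumes M: "is_gaussian M \<xi> C" and C: "linear C"
    and mean: "\<And>i. i < k \<Longrightarrow> inner (c i) \<xi> = 0"
    and on: "\<forall>i<k. \<forall>j<k. inner (C (c i)) (c j) = (if i = j then 1 else 0)"
  shows "\<And>i. i < k \<Longrightarrow> distr M borel (inner (c i)) = std_normal_distribution"
    and "prob_space.indep_vars M (\<lambda>_. borel) (\<lambda>i. inner (c i)) {..<k}"
proof -
  interpret C: linear C by fact
  have ps: "prob_space M" using M by (simp add: is_gaussian_def)
  have sM[measurable_cong]: "sets M = sets borel" using M by (simp add: is_gaussian_def)
  have meas: "inner (c i) \<in> borel_measurable M" for i by measurable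
  have ch: "(CLINT x|M. iexp (\<Sum>i<k. a i * inner (c i) x)) = (\<Prod>i<k. char std_normal_distribution (a i))" for a
  proof -
    define b where "b = (\<Sum>i<k. a i *\<^sub>R c i)"
    have lin: "linear (\<lambda>x. inner (C x) y)" for y
      by (auto intro!: linearI simp: C.add C.scale inner_add_left)
    have "inner (C b) b = (\<Sum>j<k. a j * inner (C b) (c j))" by (simp add: b_def inner_sum_right)
    also have "\<dots> = (\<Sum>j<k. a j * a j)"
      unfolding b_def using orthonormal_sum[of "\<lambda>x y. inner (C x) y", OF lin on] by simp
    finally have bb: "inner (C b) b = (\<Sum>j<k. (a j)\<^sup>2)" by (simp add: power2_eq_square)
    have "(\<Sum>i<k. a i * inner (c i) x) = inner b x" for x by (simp add: b_def inner_sum_left)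
    then have "(CLINT x|M. iexp (\<Sum>i<k. a i * inner (c i) x)) = (CLINT x|M. iexp (inner b x))" by simp
    also have "\<dots> = exp (- (\<Sum>j<k. (a j)\<^sup>2) / 2)"
    proof -
      have "inner b \<xi> = 0" using mean by (simp add: b_def inner_sum_left)
      moreover have "0 \<le> inner (C b) b" by (simp add: bb sum_nonneg)
      ultimately show ?thesis using gaussian_char[OF M, of b] by (simp only: bb)
    qed
    also have "\<dots> = complex_of_real (\<Prod>j<k. exp (- (a j)\<^sup>2 / 2))"
      by (simp add: exp_sum[symmetric] sum_negf sum_divide_distrib)
    finally show ?thesis by (simp add: char_std_normal_distribution)
  qed
  show "\<And>i. i < k \<Longrightarrow> distr M borel (inner (c i)) = std_normal_distribution"
    by (rule indep_vars_from_char(1)[OF ps meas real_dist_normal_dist ch])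
  show "prob_space.indep_vars M (\<lambda>_. borel) (\<lambda>i. inner (c i)) {..<k}"
    by (rule indep_vars_from_char(2)[OF ps meas real_dist_normal_dist ch])
qed

text \<open>
  The image of the measure under \<open>L\<close> is Gaussian with zero mean and covariance \<open>L C L'\<close>, where \<open>L'\<close> is the
  adjoint. If the latter has no variance in any direction, each functional of \<open>L y\<close> vanishes almost surely;
  separability allows treating a dense set of functionals at once.
\<close>

lemma gaussian_null_operator:
  fixes M :: "'h::{real_inner,second_countable_topology} measure" and L L' :: "'h \<Rightarrow> 'h"
  assumes M: "is_gaussian M \<xi> C" and adj: "\<And>b y. inner b (L y) = inner (L' b) y"
    and mean: "\<And>b. inner (L' b) \<xi> = 0" and var: "\<And>b. inner (C (L' b)) (L' b) = 0"
  shows "AE y in M. L y = 0"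
proof -
  interpret prob_space M using M by (simp add: is_gaussian_def)
  have sM[measurable_cong]: "sets M = sets borel" using M by (simp add: is_gaussian_def)
  obtain D :: "'h set" where D: "countable D" "\<And>X. open X \<Longrightarrow> X \<noteq> {} \<Longrightarrow> \<exists>d\<in>D. d \<in> X"
    using countable_dense_exists by blast
  have "AE y in M. inner b (L y) = 0" for b
  proof -
    have "distr M borel (inner (L' b)) = normal_law (inner (L' b) \<xi>) (inner (C (L' b)) (L' b))"
      using M by (simp add: is_gaussian_def)
    then have "distr M borel (inner (L' b)) = return borel 0"
      by (simp add: mean var normal_law_def)
    moreover have "AE x in return borel (0::real). x = 0" by (subst AE_return) auto
    ultimately have "AE x in distr M borel (inner (L' b)). x = 0" by (simp only:)
    then have "AE y in M. inner (L' b) y = 0" by (subst (asm) AE_distr_iff) auto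
    then show ?thesis by (simp add: adj)
  qed
  then have "AE y in M. \<forall>b\<in>D. inner b (L y) = 0" using D(1) by (simp add: AE_ball_countable)
  then show ?thesis
  proof (rule AE_mp, intro AE_I2 impI)
    fix y assume y: "\<forall>b\<in>D. inner b (L y) = 0"
    show "L y = 0"
    proof (rule ccontr)
      assume "L y \<noteq> 0"
      then obtain d where d: "d \<in> D" "d \<in> ball (L y) (norm (L y))"
        using D(2)[of "ball (L y) (norm (L y))"] by auto
      have "(dist (L y) d)\<^sup>2 = (norm (L y))\<^sup>2 + (norm d)\<^sup>2"
        unfolding dist_norm power2_norm_eq_inner using y d(1)
        by (simp add: inner_diff_left inner_diff_right inner_commute[of "L y" d])
      moreover have "(dist (L y) d)\<^sup>2 < (norm (L y))\<^sup>2"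
        using d(2) by (intro power_strict_mono) auto
      ultimately show False by (smt (verit) zero_le_power2)
    qed
  qed
qed

text \<open>
  Of the subspaces only the algebra of the two projections matters. The \<open>f i\<close> have to span the range of
  \<open>Q P1\<close>, as the numerator is bounded from above; the \<open>e j\<close> may be any orthonormal eigenvectors, as
  the denominator is bounded from below. The variance \<open>v\<close> scales both alike and cancels.
\<close>

lemma gaussian_fisher_test:
  fixes M :: "'h::{real_inner,second_countable_topology} measure" and Q P1 P2 :: "'h \<Rightarrow> 'h"
    and f e :: "nat \<Rightarrow> 'h"
  assumes M: "is_gaussian M \<xi> (\<lambda>x. v *\<^sub>R Q x)" and v: "0 < v"
    and Q: "bounded_linear Q" "self_adjoint Q"
    and P1: "bounded_linear P1" "self_adjoint P1" "\<And>x. P1 (P1 x) = P1 x" "\<And>x. P1 (Q x) = Q (P1 x)"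
    and P2: "bounded_linear P2" "self_adjoint P2" "\<And>x. P2 (P2 x) = P2 x" "\<And>x. P2 (Q x) = Q (P2 x)"
    and P12: "\<And>x. P1 (P2 x) = 0"
    and mean: "P1 \<xi> = 0" "P2 \<xi> = 0"
    and nonneg: "nonneg_operator Q"
    and f: "\<forall>i<m. \<forall>j<m. inner (Q (f i)) (f j) = (if i = j then 1 else 0)"
      "span (f ` {..<m}) = range (\<lambda>x. Q (P1 x))"
    and e: "\<forall>i<n. \<forall>j<n. inner (e i) (e j) = (if i = j then 1 else 0)"
      "\<And>j. j < n \<Longrightarrow> Q (P2 (e j)) = lam *\<^sub>R e j"
    and lam: "0 < lam" and \<mu>: "\<mu> = onorm (\<lambda>x. Q (P1 x))" "0 < \<mu>"
    and mn: "0 < m" "0 < n" and \<alpha>: "0 < \<alpha>" "\<alpha> < 1"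
  shows "measure M {y. quantile (fisher_distribution m n) (1 - \<alpha>) \<le>
    real n * lam / (real m * \<mu>) * ((norm (P1 y))\<^sup>2 / (norm (P2 y))\<^sup>2)} \<le> \<alpha>"
proof -
  interpret prob_space M using M by (simp add: is_gaussian_def)
  have sM[measurable_cong]: "sets M = sets borel" using M by (simp add: is_gaussian_def)
  have spM: "space M = UNIV" using sets_eq_imp_space_eq[OF sM] by simp
  interpret Q: bounded_linear Q by fact
  interpret P1: bounded_linear P1 by fact
  interpret P2: bounded_linear P2 by fact
  have Qs: "inner (Q x) y = inner x (Q y)" for x y using Q(2) by (simp add: self_adjoint_def)
  have P1s: "inner (P1 x) y = inner x (P1 y)" for x y using P1(2) by (simp add: self_adjoint_def)
  have P2s: "inner (P2 x) y = inner x (P2 y)" for x y using P2(2) by (simp add: self_adjoint_def)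
  have Pf: "P1 (f i) = f i" if "i < m" for i
  proof -
    have "f i \<in> range (\<lambda>x. Q (P1 x))" unfolding f(2)[symmetric] using that by (auto intro: span_base)
    then show ?thesis by (auto simp: P1)
  qed
  have Pe: "P2 (e j) = e j" if "j < n" for j
  proof -
    have "lam *\<^sub>R P2 (e j) = P2 (Q (P2 (e j)))" using that by (simp add: e(2) P2.scaleR)
    also have "\<dots> = Q (P2 (e j))" by (simp only: P2(3,4))
    also have "\<dots> = lam *\<^sub>R e j" using that by (rule e(2))
    finally show ?thesis using lam by simp
  qed
  have Qe: "Q (e j) = lam *\<^sub>R e j" if "j < n" for j using e(2)[OF that] Pe[OF that] by simp
  have fe: "inner (f i) (e j) = 0" if "i < m" "j < n" for i j
  proof -
    have "inner (f i) (e j) = inner (P1 (f i)) (P2 (e j))" using that by (simp only: Pf Pe)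
    also have "\<dots> = inner (f i) (P1 (P2 (e j)))" by (rule P1s)
    finally show ?thesis by (simp add: P12)
  qed
  have linQ: "linear (\<lambda>x. inner (Q x) y)" for y
    by (auto intro!: linearI simp: Q.add Q.scaleR inner_add_left)
  define s where "s = sqrt v"
  have s: "0 < s" "s\<^sup>2 = v" using v by (auto simp: s_def)
  define l where "l = sqrt lam"
  have l: "0 < l" "l\<^sup>2 = lam" using lam by (auto simp: l_def)
  \<comment> \<open>The first \<open>m\<close> coordinates serve the numerator, the last \<open>n\<close> the denominator; the factors
    normalize the covariance form \<open>\<langle>v Q x, y\<rangle>\<close>.\<close>
  define c where "c i = (if i < m then (1 / s) *\<^sub>R f i else (1 / (s * l)) *\<^sub>R e (i - m))" for i
  define Z where "Z i y = inner (c i) y" for i y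
  have cmean: "inner (c i) \<xi> = 0" if "i < m + n" for i
  proof (cases "i < m")
    case True
    have "inner (f i) \<xi> = inner (f i) (P1 \<xi>)" using P1s[of "f i" \<xi>] True by (simp add: Pf)
    then show ?thesis using True by (simp add: c_def mean)
  next
    case False
    then have "i - m < n" using that by simp
    then have "inner (e (i - m)) \<xi> = inner (e (i - m)) (P2 \<xi>)" using P2s[of "e (i - m)" \<xi>] by (simp add: Pe)
    then show ?thesis using False by (simp add: c_def mean)
  qed
  have con: "\<forall>i<m+n. \<forall>j<m+n. inner (v *\<^sub>R Q (c i)) (c j) = (if i = j then 1 else 0)"
  proof (intro allI impI)
    fix i j assume ij: "i < m + n" "j < m + n"
    have ee: "inner (Q (e a)) (e b) = (if a = b then l\<^sup>2 else 0)" if "a < n" "b < n" for a b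
      using that e(1) by (simp add: Qe l(2))
    have ef: "inner (Q (e a)) (f b) = 0" if "a < n" "b < m" for a b
      using fe[OF that(2,1)] that by (simp add: Qe inner_commute)
    have fe': "inner (Q (f b)) (e a) = 0" if "a < n" "b < m" for a b
      using ef[OF that] Qs by (simp add: inner_commute)
    consider "i < m" "j < m" | "i < m" "\<not> j < m" | "\<not> i < m" "j < m" | "\<not> i < m" "\<not> j < m" by blast
    then show "inner (v *\<^sub>R Q (c i)) (c j) = (if i = j then 1 else 0)"
    proof cases
      case 1
      then show ?thesis using f(1) s by (simp add: c_def Q.scaleR power2_eq_square[symmetric] field_simps flip: s(2))
    next
      case 2
      then show ?thesis using ij by (simp add: c_def Q.scaleR fe')
    next
      case 3
      then show ?thesis using ij by (simp add: c_def Q.scaleR ef)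
    next
      case 4
      then have "i - m < n" "j - m < n" "i - m = j - m \<longleftrightarrow> i = j" using ij by auto
      then show ?thesis using 4 s l lam
        by (simp add: c_def Q.scaleR ee power2_eq_square field_simps flip: s(2))
    qed
  qed
  have linC: "linear (\<lambda>x. v *\<^sub>R Q x)"
    by (auto intro!: linearI simp: Q.add Q.scaleR scaleR_add_right)
  note white = gaussian_white_coordinates[OF M linC cmean con]
  have XZ: "(\<Sum>i\<in>{0..<m}. (Z i y)\<^sup>2) = (\<Sum>i<m. (inner (f i) y)\<^sup>2) / v" for y
    unfolding atLeast0LessThan sum_divide_distrib
    using s by (intro sum.cong) (auto simp: Z_def c_def power_divide)
  have YZ: "(\<Sum>i\<in>{m..<m+n}. (Z i y)\<^sup>2) = (\<Sum>j<n. (inner (e j) y)\<^sup>2) / (v * lam)" for y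
  proof -
    have "(\<Sum>i\<in>{m..<m+n}. (Z i y)\<^sup>2) = (\<Sum>j<n. (Z (m + j) y)\<^sup>2)"
      by (rule sum.reindex_bij_witness[of _ "\<lambda>j. m + j" "\<lambda>i. i - m"]) auto
    also have "\<dots> = (\<Sum>j<n. (inner (e j) y)\<^sup>2 / (v * lam))"
      using s l by (intro sum.cong) (auto simp: Z_def c_def power_divide power_mult_distrib)
    finally show ?thesis by (simp add: sum_divide_distrib)
  qed
  note T1 = compression_self_adjoint_nonneg[OF Q nonneg P1]
  \<comment> \<open>The operator \<open>b \<mapsto> P1 b - \<Sum> \<langle>Q f_i, b\<rangle> f_i\<close> is the adjoint of the one that should vanish.\<close>
  have repr: "AE y in M. P1 y - (\<Sum>i<m. inner (f i) y *\<^sub>R Q (f i)) = 0"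
  proof (rule gaussian_null_operator[OF M, where L' = "\<lambda>b. P1 b - (\<Sum>i<m. inner (Q (f i)) b *\<^sub>R f i)"])
    fix b y :: 'h
    show "inner b (P1 y - (\<Sum>i<m. inner (f i) y *\<^sub>R Q (f i))) = inner (P1 b - (\<Sum>i<m. inner (Q (f i)) b *\<^sub>R f i)) y"
      by (simp add: inner_diff_left inner_diff_right inner_sum_left inner_sum_right P1s inner_commute[of b] mult.commute)
  next
    fix b
    have "inner (f i) \<xi> = 0" if "i < m" for i
      using P1s[of "f i" \<xi>] that by (simp add: Pf mean)
    then show "inner (P1 b - (\<Sum>i<m. inner (Q (f i)) b *\<^sub>R f i)) \<xi> = 0"
      by (simp add: inner_diff_left inner_sum_left P1s mean)
    \<comment> \<open>\<open>w\<close> lies in the span of the \<open>f i\<close> and is orthogonal to each of them.\<close>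
    define w where "w = Q (P1 b - (\<Sum>i<m. inner (Q (f i)) b *\<^sub>R f i))"
    have wS: "w = Q (P1 b) - (\<Sum>i<m. inner (Q (f i)) b *\<^sub>R Q (f i))"
      by (simp add: w_def Q.diff Q.sum Q.scaleR)
    have wf: "inner w (f j) = 0" if "j < m" for j
    proof -
      have "inner (Q (\<Sum>i<m. inner (Q (f i)) b *\<^sub>R f i)) (f j) = inner (Q (f j)) b"
        using orthonormal_sum[of "\<lambda>x y. inner (Q x) y", OF linQ f(1) that] .
      moreover have "inner (Q (P1 b)) (f j) = inner (Q (f j)) b"
        using that by (simp add: Qs P1s P1(4) Pf inner_commute[of b])
      ultimately show ?thesis by (simp add: w_def Q.diff inner_diff_left)
    qed
    have "w \<in> span (f ` {..<m})"
    proof -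
      have "Q (f i) \<in> range (\<lambda>x. Q (P1 x))" if "i < m" for i
        using Pf[OF that] by (metis rangeI)
      then show ?thesis unfolding wS f(2)[symmetric]
        by (intro span_diff span_sum span_scale) (auto simp: f(2))
    qed
    then obtain a where "w = (\<Sum>i<m. a i *\<^sub>R f i)" by (rule span_image_lessThan)
    then have "inner w w = (\<Sum>i<m. a i * inner w (f i))" by (metis (no_types, lifting) inner_scaleR_right inner_sum_right sum.cong)
    then have "w = 0" using wf by simp
    then show "inner (v *\<^sub>R Q (P1 b - (\<Sum>i<m. inner (Q (f i)) b *\<^sub>R f i))) (P1 b - (\<Sum>i<m. inner (Q (f i)) b *\<^sub>R f i)) = 0"
      by (simp add: w_def)
  qed
  have num: "(norm (P1 y))\<^sup>2 \<le> \<mu> * (\<Sum>i<m. (inner (f i) y)\<^sup>2)"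
    if "P1 y - (\<Sum>i<m. inner (f i) y *\<^sub>R Q (f i)) = 0" for y
  proof -
    define w where "w = (\<Sum>i<m. inner (f i) y *\<^sub>R f i)"
    have Pw: "P1 w = w" by (simp add: w_def P1.sum P1.scaleR Pf)
    have "P1 y = Q w" using that by (simp add: w_def Q.sum Q.scaleR)
    then have "(norm (P1 y))\<^sup>2 = (norm (Q (P1 w)))\<^sup>2" by (simp add: Pw)
    also have "\<dots> \<le> \<mu> * inner (Q (P1 w)) w" unfolding \<mu>(1) by (rule norm_sq_le_onorm_form[OF T1])
    also have "inner (Q (P1 w)) w = (\<Sum>j<m. inner (f j) y * inner (Q w) (f j))"
      unfolding Pw by (subst (2) w_def) (simp add: inner_sum_right)
    also have "\<dots> = (\<Sum>j<m. (inner (f j) y)\<^sup>2)"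
      unfolding w_def using orthonormal_sum[of "\<lambda>x y. inner (Q x) y", OF linQ f(1)]
      by (simp add: power2_eq_square)
    finally show ?thesis .
  qed
  have den: "(\<Sum>j<n. (inner (e j) y)\<^sup>2) \<le> (norm (P2 y))\<^sup>2" for y
  proof -
    have "inner (e j) y = inner (P2 y) (e j)" if "j < n" for j
      using that by (simp add: P2s Pe inner_commute)
    then have "(\<Sum>j<n. (inner (e j) y)\<^sup>2) = (\<Sum>j<n. (inner (P2 y) (e j))\<^sup>2)" by simp
    also have "\<dots> \<le> (norm (P2 y))\<^sup>2" by (rule Bessel(2)[OF e(1)])
    finally show ?thesis .
  qed
  define T where "T y = real n * lam / (real m * \<mu>) * ((norm (P1 y))\<^sup>2 / (norm (P2 y))\<^sup>2)" for y
  have [measurable]: "P1 \<in> borel_measurable borel" "P2 \<in> borel_measurable borel"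
    by (simp_all add: borel_measurable_continuous_onI linear_continuous_on P1(1) P2(1))
  have "prob {y \<in> space M. quantile (fisher_distribution m n) (1 - \<alpha>) \<le> T y} \<le> \<alpha>"
  proof (rule fisher_tail[OF mn, of Z])
    show "indep_vars (\<lambda>_. borel) Z {..<m + n}" using white(2) by (simp add: Z_def[abs_def])
    show "distr M borel (Z i) = std_normal_distribution" if "i < m + n" for i
      using white(1)[of i] that by (simp add: Z_def[abs_def])
    show "T \<in> borel_measurable M" unfolding T_def by measurable
    show "AE y in M. (\<Sum>i\<in>{m..<m+n}. (Z i y)\<^sup>2) \<noteq> 0 \<longrightarrow>
      T y \<le> ((\<Sum>i\<in>{0..<m}. (Z i y)\<^sup>2) / real m) / ((\<Sum>i\<in>{m..<m+n}. (Z i y)\<^sup>2) / real n)"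
      using repr
    proof (rule AE_mp, intro AE_I2 impI)
      fix y
      assume 1: "P1 y - (\<Sum>i<m. inner (f i) y *\<^sub>R Q (f i)) = 0"
        and 2: "(\<Sum>i\<in>{m..<m+n}. (Z i y)\<^sup>2) \<noteq> 0"
      let ?X = "\<Sum>i<m. (inner (f i) y)\<^sup>2" and ?Y = "\<Sum>j<n. (inner (e j) y)\<^sup>2"
      have Y: "0 < ?Y" using 2 by (simp add: YZ less_le sum_nonneg)
      have "(norm (P1 y))\<^sup>2 / (norm (P2 y))\<^sup>2 \<le> (\<mu> * ?X) / ?Y"
        by (rule frac_le) (use num[OF 1] den Y \<mu>(2) in \<open>auto intro!: mult_nonneg_nonneg sum_nonneg\<close>)
      then have "T y \<le> real n * lam / (real m * \<mu>) * ((\<mu> * ?X) / ?Y)"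
        unfolding T_def using lam \<mu>(2) by (intro mult_left_mono) auto
      also have "\<dots> = ((\<Sum>i\<in>{0..<m}. (Z i y)\<^sup>2) / real m) / ((\<Sum>i\<in>{m..<m+n}. (Z i y)\<^sup>2) / real n)"
        unfolding XZ YZ using v lam \<mu>(2) mn Y by (simp add: field_simps)
      finally show "T y \<le> ((\<Sum>i\<in>{0..<m}. (Z i y)\<^sup>2) / real m) / ((\<Sum>i\<in>{m..<m+n}. (Z i y)\<^sup>2) / real n)" .
    qed
  qed (use \<alpha> in auto)
  then show ?thesis by (simp add: spM T_def)
qed

theorem corollary10p5:
  fixes Q :: "'h::{real_inner, banach, second_countable_topology} \<Rightarrow> 'h"
    and A :: "'g::{real_inner, banach, second_countable_topology} \<Rightarrow> 'h"
    and P :: "'g \<times> real \<Rightarrow> 'h measure"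
    and G\<^sub>0 :: "'g set"
    and U U\<^sub>0 :: "'h set"
    and lam \<mu> \<alpha> :: real
    and n m :: nat
  assumes Q: "bounded_linear Q" "self_adjoint Q" "nonneg_operator Q" "nuclear Q"
    and A: "bounded_linear A" "inj A"
    and U: "U = range A"
    and U_invariant: "invariant_under Q U" "invariant_under Q (orthogonal_comp U)"
    and model: "\<forall>\<beta>. \<forall>\<sigma>2>0. is_gaussian (P (\<beta>, \<sigma>2)) (A \<beta>) (\<lambda>x. \<sigma>2 *\<^sub>R Q x)"
    and G\<^sub>0: "subspace G\<^sub>0" "closed G\<^sub>0" "G\<^sub>0 \<noteq> {0}" "G\<^sub>0 \<noteq> UNIV"
    and U\<^sub>0: "U\<^sub>0 = A ` G\<^sub>0"
    and U\<^sub>0_invariant: "invariant_under Q U\<^sub>0" "invariant_under Q (orthogonal_comp U\<^sub>0 \<inter> U)"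
    and nonzero: "(\<lambda>x. Q (x - orth_proj U x)) \<noteq> (\<lambda>x. 0)"
      "(\<lambda>x. Q (orth_proj U x - orth_proj U\<^sub>0 x)) \<noteq> (\<lambda>x. 0)"
    and fin: "finite_dimensional (range (\<lambda>x. Q (orth_proj U x - orth_proj U\<^sub>0 x)))"
    and lam: "lam = onorm (\<lambda>x. Q (x - orth_proj U x))"
    and \<mu>: "\<mu> = onorm (\<lambda>x. Q (orth_proj U x - orth_proj U\<^sub>0 x))"
    and n: "n = dim {x. lam *\<^sub>R x - Q (x - orth_proj U x) = 0}"
    and m: "m = dim (range (\<lambda>x. Q (orth_proj U x - orth_proj U\<^sub>0 x)))"
    and \<alpha>: "0 < \<alpha>" "\<alpha> < 1"
  shows "has_level_of_significance P (G\<^sub>0 \<times> {0<..})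
     (indicator {y. real n * lam / (real m * \<mu>) *
          ((norm (orth_proj U y - orth_proj U\<^sub>0 y))\<^sup>2 / (norm (y - orth_proj U y))\<^sup>2)
        \<ge> quantile (fisher_distribution m n) (1 - \<alpha>)}) \<alpha>"
proof -
  interpret Q: bounded_linear Q by (rule Q(1))
  have subU: "subspace U" unfolding U by (rule linear_subspace_image[OF bounded_linear.linear[OF A(1)] subspace_UNIV])
  have subU0: "subspace U\<^sub>0" unfolding U\<^sub>0 by (rule linear_subspace_image[OF bounded_linear.linear[OF A(1)] G\<^sub>0(1)])
  have U0U: "U\<^sub>0 \<subseteq> U" using U U\<^sub>0 by auto
  define p where "p = orth_proj U"
  define p0 where "p0 = orth_proj U\<^sub>0"
  interpret p: bounded_linear p unfolding p_def by (rule bounded_linear_orth_proj[OF subU])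
  interpret p0: bounded_linear p0 unfolding p0_def by (rule bounded_linear_orth_proj[OF subU0])
  have ps: "inner (p x) y = inner x (p y)" for x y
    using self_adjoint_orth_proj[OF subU] by (simp add: p_def self_adjoint_def)
  have p0s: "inner (p0 x) y = inner x (p0 y)" for x y
    using self_adjoint_orth_proj[OF subU0] by (simp add: p0_def self_adjoint_def)
  have pQ: "p (Q x) = Q (p x)" for x unfolding p_def by (rule orth_proj_commutes[OF subU Q(1,2) U_invariant(1)])
  have p0Q: "p0 (Q x) = Q (p0 x)" for x unfolding p0_def by (rule orth_proj_commutes[OF subU0 Q(1,2) U\<^sub>0_invariant(1)])
  have pp0: "p (p0 x) = p0 x" "p0 (p x) = p0 x" for x
    unfolding p_def p0_def by (rule orth_proj_comp_subspace[OF subU0 subU U0U])+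
  have pp: "p (p x) = p x" "p0 (p0 x) = p0 x" for x
    unfolding p_def p0_def by (rule orth_proj_comp_subspace(1)[OF subU subU order_refl] orth_proj_comp_subspace(1)[OF subU0 subU0 order_refl])+
  define P1 where "P1 x = p x - p0 x" for x
  define P2 where "P2 x = x - p x" for x
  have P1: "bounded_linear P1" "self_adjoint P1" "\<And>x. P1 (P1 x) = P1 x" "\<And>x. P1 (Q x) = Q (P1 x)"
    unfolding P1_def[abs_def] self_adjoint_def
    by (auto intro: bounded_linear_sub p.bounded_linear_axioms p0.bounded_linear_axioms
        simp: p.diff p0.diff pp pp0 pQ p0Q Q.diff inner_diff_left inner_diff_right ps p0s)
  have P2: "bounded_linear P2" "self_adjoint P2" "\<And>x. P2 (P2 x) = P2 x" "\<And>x. P2 (Q x) = Q (P2 x)"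
    unfolding P2_def[abs_def] self_adjoint_def
    by (auto intro: bounded_linear_sub bounded_linear_ident p.bounded_linear_axioms
        simp: p.diff pp pQ Q.diff inner_diff_left inner_diff_right ps)
  have P12: "P1 (P2 x) = 0" for x by (simp add: P1_def P2_def p.diff p0.diff pp pp0)
  have Qs: "inner (Q x) y = inner x (Q y)" for x y using Q(2) by (simp add: self_adjoint_def)
  note T1 = compression_self_adjoint_nonneg[OF Q(1-3) P1]
    and T2 = compression_self_adjoint_nonneg[OF Q(1-3) P2]
  have \<mu>': "\<mu> = onorm (\<lambda>x. Q (P1 x))" by (simp add: \<mu> P1_def p_def p0_def)
  have lam': "lam = onorm (\<lambda>x. Q (P2 x))" by (simp add: lam P2_def p_def)
  have nz1: "(\<lambda>x. Q (P1 x)) \<noteq> (\<lambda>x. 0)" using nonzero(2) by (simp add: P1_def p_def p0_def)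
  have nz2: "(\<lambda>x. Q (P2 x)) \<noteq> (\<lambda>x. 0)" using nonzero(1) by (simp add: P2_def p_def)
  have \<mu>_pos: "0 < \<mu>" using nz1 onorm_pos_lt[OF T1(1)] unfolding \<mu>' by metis
  have lam_pos: "0 < lam" using nz2 onorm_pos_lt[OF T2(1)] unfolding lam' by metis

  define R where "R = range (\<lambda>x. Q (P1 x))"
  have subR: "subspace R" unfolding R_def
    by (rule linear_subspace_image[OF bounded_linear.linear[OF T1(1)] subspace_UNIV])
  obtain B where B: "finite B" "R \<subseteq> span B"
    using fin by (auto simp: finite_dimensional_def R_def P1_def p_def p0_def)
  obtain C where C: "C \<subseteq> R" "independent C" "R \<subseteq> span C" by (rule basis_exists)
  have finC: "finite C" using independent_span_bound[OF B(1) C(2)] C(1) B(2) by blast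
  have RC: "R = span C" using C subR by (meson span_minimal subset_antisym)
  \<comment> \<open>\<open>\<langle>Q x, x\<rangle> = 0\<close> forces \<open>Q x = 0\<close>, so that \<open>x = Q P1 z\<close> is orthogonal to itself.\<close>
  have pos: "0 < inner (Q x) x" if x: "x \<in> span C" "x \<noteq> 0" for x
  proof (rule ccontr)
    assume "\<not> 0 < inner (Q x) x"
    then have x0: "inner (Q x) x = 0" using Q(3) by (auto simp: nonneg_operator_def intro: antisym)
    obtain z where z: "x = Q (P1 z)" using x(1) RC R_def by auto
    have Px: "P1 x = x" by (simp add: z P1)
    have "(norm (Q (P1 x)))\<^sup>2 \<le> onorm (\<lambda>x. Q (P1 x)) * inner (Q (P1 x)) x"
      by (rule norm_sq_le_onorm_form[OF T1])
    then have "Q x = 0" by (simp add: Px x0)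
    then have "inner x x = 0" using Qs[of "P1 z" x] z by simp
    then show False using x(2) by simp
  qed
  have linQ: "linear (\<lambda>x. inner (Q x) y)" for y
    by (auto intro!: linearI simp: Q.add Q.scaleR inner_add_left)
  have symQ: "inner (Q x) y = inner (Q y) x" for x y by (metis Qs inner_commute)
  obtain f :: "nat \<Rightarrow> 'h" and k where
    f: "\<forall>i<k. \<forall>j<k. inner (Q (f i)) (f j) = (if i = j then 1 else 0)" "span (f ` {..<k}) = span C"
    using orthonormal_basis_of_form[of "\<lambda>x y. inner (Q x) y", OF linQ symQ finC pos] by blast
  have fR: "span (f ` {..<k}) = range (\<lambda>x. Q (P1 x))" using f(2) RC R_def by simp
  have km: "m = k"
    using dim_span_orthonormal[of "\<lambda>x y. inner (Q x) y", OF linQ f(1)]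
    by (simp add: fR m P1_def p_def p0_def)
  have m_pos: "0 < m"
  proof (rule ccontr)
    assume "\<not> 0 < m"
    then have "range (\<lambda>x. Q (P1 x)) = {0}" using fR km by simp
    then have "Q (P1 x) = 0" for x by blast
    then show False using nz1 by auto
  qed

  obtain D where D: "finite D" "{x. Q (P2 x) = lam *\<^sub>R x} = span D"
    using finite_dimensional_eigenspace[OF bounded_linear.linear[OF T2(1)] nuclear_compose[OF Q(4) P2(1)] lam_pos]
    by blast
  have lin: "linear (\<lambda>x. inner x y)" for y :: 'h
    by (simp add: bounded_linear.linear bounded_linear_inner_left)
  obtain e :: "nat \<Rightarrow> 'h" and l where
    e: "\<forall>i<l. \<forall>j<l. inner (e i) (e j) = (if i = j then 1 else 0)" "span (e ` {..<l}) = span D"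
    using orthonormal_basis_of_form[of inner, OF lin inner_commute D(1)] by auto
  have nl: "n = l"
  proof -
    have "{x. lam *\<^sub>R x - Q (x - orth_proj U x) = 0} = span (e ` {..<l})"
      unfolding e(2) D(2)[symmetric] P2_def p_def by auto
    then show ?thesis using dim_span_orthonormal[of inner, OF lin e(1)] by (simp add: n)
  qed
  have ev: "Q (P2 (e j)) = lam *\<^sub>R e j" if "j < n" for j
  proof -
    have "e j \<in> span D" unfolding e(2)[symmetric] using that nl by (auto intro: span_base)
    then show ?thesis unfolding D(2)[symmetric] by simp
  qed
  have n_pos: "0 < n"
  proof (rule ccontr)
    assume "\<not> 0 < n"
    then have "{x. Q (P2 x) = lam *\<^sub>R x} = {0}" using e(2) D(2) nl by simp
    moreover obtain x where "x \<noteq> 0" "Q (P2 x) = lam *\<^sub>R x"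
      using onorm_is_eigenvalue[OF T2 nuclear_compose[OF Q(4) P2(1)] nz2] lam' by blast
    ultimately show False by blast
  qed

  let ?q = "quantile (fisher_distribution m n) (1 - \<alpha>)"
  define E where "E = {y. ?q \<le> real n * lam / (real m * \<mu>) * ((norm (P1 y))\<^sup>2 / (norm (P2 y))\<^sup>2)}"
  have [measurable]: "P1 \<in> borel_measurable borel" "P2 \<in> borel_measurable borel"
    by (simp_all add: borel_measurable_continuous_onI linear_continuous_on P1(1) P2(1))
  have E: "E \<in> sets borel" unfolding E_def by measurable
  show ?thesis
    unfolding has_level_of_significance_def
  proof (intro ballI)
    fix \<gamma> :: "'g \<times> real" assume "\<gamma> \<in> G\<^sub>0 \<times> {0<..}"
    then obtain \<beta> v where \<gamma>: "\<gamma> = (\<beta>, v)" "\<beta> \<in> G\<^sub>0" "0 < v" by auto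
    have M: "is_gaussian (P \<gamma>) (A \<beta>) (\<lambda>x. v *\<^sub>R Q x)" using model \<gamma> by auto
    interpret prob_space "P \<gamma>" using M by (simp add: is_gaussian_def)
    have sM: "sets (P \<gamma>) = sets borel" using M by (simp add: is_gaussian_def)
    have "A \<beta> \<in> U\<^sub>0" using \<gamma>(2) U\<^sub>0 by auto
    then have "p0 (A \<beta>) = A \<beta>" "p (A \<beta>) = A \<beta>"
      using U0U closure_subset unfolding p_def p0_def
      by (blast intro: orth_proj_fixes[OF subU] orth_proj_fixes[OF subU0])+
    then have mean: "P1 (A \<beta>) = 0" "P2 (A \<beta>) = 0" by (simp_all add: P1_def P2_def)
    have "measure (P \<gamma>) E \<le> \<alpha>"
      unfolding E_def
      by (rule gaussian_fisher_test[OF M \<gamma>(3) Q(1,2) P1 P2 P12 mean Q(3) f(1)[folded km] fR[folded km]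
            e(1)[folded nl] ev lam_pos \<mu>' \<mu>_pos m_pos n_pos \<alpha>])
    moreover have "E \<in> events" using E sM by simp
    ultimately have "integrable (P \<gamma>) (indicator E :: 'h \<Rightarrow> real) \<and> integral\<^sup>L (P \<gamma>) (indicator E :: 'h \<Rightarrow> real) \<le> \<alpha>"
      by (simp add: emeasure_eq_measure less_top[symmetric])
    then show "integrable (P \<gamma>) (indicator {y. real n * lam / (real m * \<mu>) *
          ((norm (orth_proj U y - orth_proj U\<^sub>0 y))\<^sup>2 / (norm (y - orth_proj U y))\<^sup>2) \<ge> ?q} :: 'h \<Rightarrow> real) \<and>
        integral\<^sup>L (P \<gamma>) (indicator {y. real n * lam / (real m * \<mu>) *
          ((norm (orth_proj U y - orth_proj U\<^sub>0 y))\<^sup>2 / (norm (y - orth_proj U y))\<^sup>2) \<ge> ?q}) \<le> \<alpha>"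
      unfolding E_def P1_def P2_def p_def p0_def .
  qed
qed

end
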